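(* Let $G''$ be the group $$G''=\langle a,b,b',c,c' \mid a^2=1,\ ab=(b')^{-1}a,\ ac=(c')^{-1}a,\ cb^{-1}=b'(c')^{-1},\ b^{-1}c=(c')^{-1}b'\rangle .$$ For an oriented long knot diagram $K$ on the cylinder, let $\phi''(K)\in G''$ be the product, in the order in which they are met along the orientation of $K$, of the letters assigned to the endpoints of the chords of the linear Gauss diagram $G(K)$ by the following rule: - every endpoint of an even chord gets the letter $a$; - the over-endpoint of an odd chord of the first type gets $b$ if it is in even position and $b^{-1}$ if it is in odd position; - the over-endpoint of an odd chord of the second type gets $b'$ if it is in even position and $(b')^{-1}$ if it is in odd position; - the under-endpoint of an odd chord of the first type gets $c$ if it is in even position and $c^{-1}$ if it is in odd position; - the under-endpoint of an odd chord of the second type gets $c'$ if it is in even position and $(c')^{-1}$ if it is in odd position. Then $\phi''(K)$ is an invariant of oriented long knots in the full torus; that is, if $K$ and $K'$ are oriented long knot diagrams on the cylinder related by a finite sequence of Reidemeister moves, then $\phi''(K)=\phi''(K')$ in $G''$.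
   Context: **Long knot diagrams on the cylinder.** The cylinder is $C=\mathbb{R}\times S^1$ (equivalently, a twice-punctured sphere). A long knot diagram $K$ on the cylinder is a generic smooth immersion $f:\mathbb{R}\to C$ (finitely many singular points, all transverse double points) with over/under information at each double point, such that for some $r>0$ one has $f(x)=(x,\ast)$ for all $|x|>r$, where $\ast\in S^1$ is a fixed base point; so the two ends of the curve go to the two different ends of the cylinder. It is oriented by the orientation of $\mathbb{R}$. Oriented long knots in the full torus (thickened cylinder) are equivalence classes of such diagrams under the usual oriented Reidemeister moves $R_1,R_2,R_3$ (performed in discs in the cylinder) and planar isotopy of the compact part of the diagram. **Linear Gauss diagram.** The linear Gauss diagram $G(K)$ consists of the oriented line $\mathbb{R}$ together with one chord for each crossing of $K$, joining the two preimages of that crossing; one endpoint of the chord is the over-endpoint (preimage on the overcrossing strand) and the other is the under-endpoint (preimage on the undercrossing strand). Two chords are linked if their endpoints alternate along the line. **Parity.** A chord (crossing) is odd if it is linked with an odd number of chords of $G(K)$, and even if it is linked with an even number of chords of $G(K)$. **Type.** An odd chord is of the first type if it is linked with an even number of even chords, and of the second type if it is linked with an odd number of even chords. **Position.** Enumerate all chord endpoints $1,2,\dots,2m$ in the order in which they appear along the orientation of $K$. An endpoint is in odd (respectively even) position if its number is odd (respectively even). *)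

theory Defs
  imports "HOL-Analysis.Analysis" "HOL-Algebra.Group"
begin

section \<open>Groups given by generators and relations\<close>

text \<open>A letter \<open>(x, True)\<close> stands for the generator \<open>x\<close> and \<open>(x, False)\<close> for its formal
  inverse; a relation \<open>u = v\<close> is the pair \<open>(u, v)\<close> of words.\<close>

type_synonym 'g word = "('g \<times> bool) list"

inductive word_eq :: "('g word \<times> 'g word) set \<Rightarrow> 'g word \<Rightarrow> 'g word \<Rightarrow> bool"
  for R :: "('g word \<times> 'g word) set"
where
  relation: "(u, v) \<in> R \<Longrightarrow> word_eq R u v"
| cancel: "word_eq R [(x, e), (x, \<not> e)] []"
| refl: "word_eq R u u"
| sym: "word_eq R u v \<Longrightarrow> word_eq R v u"
| trans: "word_eq R u v \<Longrightarrow> word_eq R v w \<Longrightarrow> word_eq R u w"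
| append: "word_eq R u u' \<Longrightarrow> word_eq R v v' \<Longrightarrow> word_eq R (u @ v) (u' @ v')"

definition word_class :: "('g word \<times> 'g word) set \<Rightarrow> 'g word \<Rightarrow> 'g word set" where
  "word_class R u = {v. word_eq R u v}"

definition presented_group :: "('g word \<times> 'g word) set \<Rightarrow> 'g word set monoid" where
  "presented_group R =
     \<lparr>carrier = range (word_class R),
      mult = (\<lambda>A B. \<Union>u\<in>A. \<Union>v\<in>B. word_class R (u @ v)),
      one = word_class R []\<rparr>"

definition gen :: "('g word \<times> 'g word) set \<Rightarrow> 'g \<Rightarrow> 'g word set" where
  "gen R x = word_class R [(x, True)]"

lemma word_class_eq_iff: "word_class R u = word_class R v \<longleftrightarrow> word_eq R u v"
proof
  assume "word_class R u = word_class R v"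
  moreover have "v \<in> word_class R v"
    by (simp add: word_class_def word_eq.refl)
  ultimately have "v \<in> word_class R u"
    by (simp only:)
  then show "word_eq R u v"
    by (simp add: word_class_def)
next
  assume uv: "word_eq R u v"
  show "word_class R u = word_class R v"
    unfolding word_class_def
    using word_eq.trans[OF uv] word_eq.trans[OF word_eq.sym[OF uv]] by blast
qed

lemma presented_group_mult:
  "word_class R u \<otimes>\<^bsub>presented_group R\<^esub> word_class R v = word_class R (u @ v)"
proof -
  have "word_class R (u' @ v') = word_class R (u @ v)"
    if "u' \<in> word_class R u" "v' \<in> word_class R v" for u' v'
  proof -
    from that have "word_eq R u u'" "word_eq R v v'"
      by (simp_all add: word_class_def)
    then show ?thesis
      unfolding word_class_eq_iff by (intro word_eq.sym[OF word_eq.append])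
  qed
  moreover have "u \<in> word_class R u" "v \<in> word_class R v"
    by (auto simp: word_class_def intro: word_eq.refl)
  ultimately have "(\<Union>u'\<in>word_class R u. \<Union>v'\<in>word_class R v. word_class R (u' @ v'))
      = word_class R (u @ v)"
    by blast
  then show ?thesis
    by (simp only: presented_group_def monoid.simps)
qed

definition word_inv :: "'g word \<Rightarrow> 'g word" where
  "word_inv u = rev (map (\<lambda>(x, e). (x, \<not> e)) u)"

lemma word_eq_inv: "word_eq R (word_inv u @ u) []"
proof (induction u)
  case Nil
  show ?case by (simp add: word_inv_def word_eq.refl)
next
  case (Cons l u)
  obtain x e where l: "l = (x, e)" by fastforce
  have "word_eq R [(x, \<not> e), (x, e)] []"
    using word_eq.cancel[of R x "\<not> e"] by simp
  then have "word_eq R (word_inv u @ [(x, \<not> e), (x, e)] @ u) (word_inv u @ [] @ u)"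
    by (intro word_eq.append word_eq.refl)
  then have "word_eq R (word_inv (l # u) @ l # u) (word_inv u @ u)"
    by (simp add: word_inv_def l)
  from this Cons.IH show ?case
    by (rule word_eq.trans)
qed

lemma presented_group_is_group: "group (presented_group R)"
proof (rule groupI)
  show one: "\<one>\<^bsub>presented_group R\<^esub> \<in> carrier (presented_group R)"
    by (simp add: presented_group_def)
  have one_eq: "\<one>\<^bsub>presented_group R\<^esub> = word_class R []"
    by (simp add: presented_group_def)
  have cls: "\<exists>u. A = word_class R u" if "A \<in> carrier (presented_group R)" for A
    using that by (auto simp: presented_group_def)
  have cl: "word_class R u \<in> carrier (presented_group R)" for u
    by (simp add: presented_group_def)
  show "A \<otimes>\<^bsub>presented_group R\<^esub> B \<in> carrier (presented_group R)"
    if "A \<in> carrier (presented_group R)" "B \<in> carrier (presented_group R)" for A B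
    using cls[OF that(1)] cls[OF that(2)] cl by (auto simp: presented_group_mult)
  show "A \<otimes>\<^bsub>presented_group R\<^esub> B \<otimes>\<^bsub>presented_group R\<^esub> D
      = A \<otimes>\<^bsub>presented_group R\<^esub> (B \<otimes>\<^bsub>presented_group R\<^esub> D)"
    if "A \<in> carrier (presented_group R)" "B \<in> carrier (presented_group R)"
      "D \<in> carrier (presented_group R)" for A B D
    using cls[OF that(1)] cls[OF that(2)] cls[OF that(3)]
    by (auto simp: presented_group_mult)
  show "\<one>\<^bsub>presented_group R\<^esub> \<otimes>\<^bsub>presented_group R\<^esub> A = A"
    if "A \<in> carrier (presented_group R)" for A
    using cls[OF that] by (auto simp: presented_group_mult one_eq)
  show "\<exists>B\<in>carrier (presented_group R). B \<otimes>\<^bsub>presented_group R\<^esub> A = \<one>\<^bsub>presented_group R\<^esub>"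
    if "A \<in> carrier (presented_group R)" for A
  proof -
    from cls[OF that] obtain u where A: "A = word_class R u" ..
    have "word_class R (word_inv u) \<otimes>\<^bsub>presented_group R\<^esub> A = \<one>\<^bsub>presented_group R\<^esub>"
      by (simp add: A presented_group_mult one_eq word_class_eq_iff word_eq_inv)
    with cl show ?thesis by blast
  qed
qed

section \<open>The group \<open>G''\<close>\<close>

text \<open>\<open>Gb'\<close> and \<open>Gc'\<close> are the primed generators.\<close>

datatype generator = Ga | Gb | Gb' | Gc | Gc'

definition G2_rels :: "(generator word \<times> generator word) set" where
  "G2_rels =
    {([(Ga, True), (Ga, True)], []),
     ([(Ga, True), (Gb, True)], [(Gb', False), (Ga, True)]),
     ([(Ga, True), (Gc, True)], [(Gc', False), (Ga, True)]),
     ([(Gc, True), (Gb, False)], [(Gb', True), (Gc', False)]),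
     ([(Gb, False), (Gc, True)], [(Gc', False), (Gb', True)])}"

definition G2 :: "generator word set monoid" where
  "G2 = presented_group G2_rels"

section \<open>Linear Gauss diagrams\<close>

text \<open>A chord is the pair of its over-endpoint and its under-endpoint on the oriented line.\<close>

type_synonym chord = "real \<times> real"

definition endpoints :: "chord set \<Rightarrow> real set" where
  "endpoints G = fst ` G \<union> snd ` G"

fun linked :: "chord \<Rightarrow> chord \<Rightarrow> bool" where
  "linked (p, q) (p', q') \<longleftrightarrow>
     (min p q < min p' q' \<and> min p' q' < max p q \<and> max p q < max p' q') \<or>
     (min p' q' < min p q \<and> min p q < max p' q' \<and> max p' q' < max p q)"

definition odd_chord :: "chord set \<Rightarrow> chord \<Rightarrow> bool" where
  "odd_chord G c \<longleftrightarrow> odd (card {d \<in> G. linked c d})"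

definition even_chord :: "chord set \<Rightarrow> chord \<Rightarrow> bool" where
  "even_chord G c \<longleftrightarrow> even (card {d \<in> G. linked c d})"

text \<open>An odd chord that is not of the first type is of the second type.\<close>

definition first_type :: "chord set \<Rightarrow> chord \<Rightarrow> bool" where
  "first_type G c \<longleftrightarrow> odd_chord G c \<and> even (card {d \<in> G. even_chord G d \<and> linked c d})"

definition position :: "chord set \<Rightarrow> real \<Rightarrow> nat" where
  "position G x = card {y \<in> endpoints G. y \<le> x}"

definition chord_at :: "chord set \<Rightarrow> real \<Rightarrow> chord" where
  "chord_at G x = (THE c. c \<in> G \<and> (x = fst c \<or> x = snd c))"

definition signed_gen :: "chord set \<Rightarrow> real \<Rightarrow> generator \<Rightarrow> generator word set" where
  "signed_gen G x g =
     (if even (position G x) then gen G2_rels g else inv\<^bsub>G2\<^esub> (gen G2_rels g))"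

definition endpoint_letter :: "chord set \<Rightarrow> real \<Rightarrow> generator word set" where
  "endpoint_letter G x =
     (let c = chord_at G x in
      if even_chord G c then gen G2_rels Ga
      else if x = fst c then signed_gen G x (if first_type G c then Gb else Gb')
      else signed_gen G x (if first_type G c then Gc else Gc'))"

definition gauss_phi :: "chord set \<Rightarrow> generator word set" where
  "gauss_phi G =
     foldr (\<lambda>x g. endpoint_letter G x \<otimes>\<^bsub>G2\<^esub> g) (sorted_list_of_set (endpoints G)) \<one>\<^bsub>G2\<^esub>"

section \<open>Long knot diagrams on the cylinder\<close>

definition cylinder :: "(real \<times> complex) set" where
  "cylinder = UNIV \<times> sphere 0 1"

text \<open>The field \<open>over\<close> is the set of those preimages of double points that lie on the
  overcrossing strand.\<close>

record diagram =
  curve :: "real \<Rightarrow> real \<times> complex"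
  over :: "real set"

definition smooth_curve :: "(real \<Rightarrow> 'a::real_normed_vector) \<Rightarrow> bool" where
  "smooth_curve f \<longleftrightarrow>
     (\<exists>D :: nat \<Rightarrow> real \<Rightarrow> 'a.
        D 0 = f \<and> (\<forall>n x. (D n has_vector_derivative D (Suc n) x) (at x)))"

definition crossing_params :: "(real \<Rightarrow> 'a) \<Rightarrow> real set" where
  "crossing_params f = {s. \<exists>t. t \<noteq> s \<and> f t = f s}"

text \<open>Transversality at a double point says that the two velocities, which are nonzero, are not
  proportional; both lie in the tangent plane of the cylinder.\<close>

definition generic_immersion :: "(real \<Rightarrow> real \<times> complex) \<Rightarrow> bool" where
  "generic_immersion f \<longleftrightarrow>
     range f \<subseteq> cylinder \<and> smooth_curve f \<and>
     (\<forall>x. vector_derivative f (at x) \<noteq> 0) \<and>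
     finite (crossing_params f) \<and>
     (\<forall>s t u. f s = f t \<and> f t = f u \<longrightarrow> s = t \<or> t = u \<or> s = u) \<and>
     (\<forall>s t k. s \<noteq> t \<and> f s = f t \<longrightarrow>
        vector_derivative f (at s) \<noteq> k *\<^sub>R vector_derivative f (at t))"

definition long_knot_diagram :: "complex \<Rightarrow> diagram \<Rightarrow> bool" where
  "long_knot_diagram pt K \<longleftrightarrow>
     generic_immersion (curve K) \<and>
     (\<exists>r>0. \<forall>x. \<bar>x\<bar> > r \<longrightarrow> curve K x = (x, pt)) \<and>
     over K \<subseteq> crossing_params (curve K) \<and>
     (\<forall>s t. s \<noteq> t \<and> curve K s = curve K t \<longrightarrow> (s \<in> over K \<longleftrightarrow> t \<notin> over K))"

definition gauss_diagram :: "diagram \<Rightarrow> chord set" where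
  "gauss_diagram K = {(s, t). s \<noteq> t \<and> curve K s = curve K t \<and> s \<in> over K}"

definition phi2 :: "diagram \<Rightarrow> generator word set" where
  "phi2 K = gauss_phi (gauss_diagram K)"

section \<open>Planar isotopy and Reidemeister moves\<close>

text \<open>Ambient isotopies of the cylinder supported away from its two ends, combined with
  orientation preserving reparametrisations of the line that are the identity near infinity.\<close>

definition planar_isotopic :: "diagram \<Rightarrow> diagram \<Rightarrow> bool" where
  "planar_isotopic K K' \<longleftrightarrow>
     (\<exists>(H :: real \<Rightarrow> real \<times> complex \<Rightarrow> real \<times> complex) (\<rho> :: real \<Rightarrow> real) r.
        continuous_on ({0..1} \<times> cylinder) (\<lambda>(\<tau>, z). H \<tau> z) \<and>
        (\<forall>\<tau>\<in>{0..1}. \<exists>g. homeomorphism cylinder cylinder (H \<tau>) g) \<and>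
        (\<forall>z\<in>cylinder. H 0 z = z) \<and>
        (\<forall>\<tau>\<in>{0..1}. \<forall>z\<in>cylinder. \<bar>fst z\<bar> > r \<longrightarrow> H \<tau> z = z) \<and>
        strict_mono \<rho> \<and> surj \<rho> \<and> (\<forall>x. \<bar>x\<bar> > r \<longrightarrow> \<rho> x = x) \<and>
        curve K' = H 1 \<circ> curve K \<circ> \<rho> \<and>
        over K' = \<rho> -` over K)"

text \<open>A local picture is a list of arcs, parametrised by \<open>{-2..2}\<close>, in the standard closed disc
  \<open>std_disc\<close>; each arc meets the boundary of the disc exactly in its two endpoints.\<close>

definition std_disc :: "(real \<times> real) set" where
  "std_disc = cbox (-2, -4) (2, 4)"

text \<open>\<open>local_move P P' K K'\<close>: there is a disc \<open>E\<close> in the cylinder such that \<open>K\<close> and \<open>K'\<close> agree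
  outside \<open>E\<close>, and inside \<open>E\<close> they are homeomorphic images of the pictures \<open>P\<close> and \<open>P'\<close>,
  respectively, the two homeomorphisms from \<open>std_disc\<close> onto \<open>E\<close> agreeing on the boundary. They
  need not preserve the orientation, and each arc of a picture may be traversed in either
  direction, so that \<open>P\<close> and \<open>P'\<close> also represent their mirror images and all orientations.
  The \<open>i\<close>-th arc is traversed by the parameters in \<open>{s i..t i}\<close>, and \<open>h i\<close> is its height:
  at a crossing of two different arcs the higher one passes over. The over/under information
  at a self-crossing of an arc is arbitrary.\<close>

definition local_move ::
    "(real \<Rightarrow> real \<times> real) list \<Rightarrow> (real \<Rightarrow> real \<times> real) list \<Rightarrow> diagram \<Rightarrow> diagram \<Rightarrow> bool" where
  "local_move P P' K K' \<longleftrightarrow>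
     length P = length P' \<and>
     (\<exists>E e e' g g' s t \<psi> \<psi>' (h :: nat \<Rightarrow> nat).
        let N = {..<length P} in
        E \<subseteq> cylinder \<and>
        homeomorphism std_disc E e g \<and> homeomorphism std_disc E e' g' \<and>
        (\<forall>z\<in>frontier std_disc. e z = e' z) \<and>
        (\<forall>i\<in>N. s i < t i) \<and>
        (\<forall>i\<in>N. \<forall>j\<in>N. i \<noteq> j \<longrightarrow> {s i..t i} \<inter> {s j..t j} = {}) \<and>
        curve K -` E = (\<Union>i\<in>N. {s i..t i}) \<and>
        curve K' -` E = (\<Union>i\<in>N. {s i..t i}) \<and>
        (\<forall>x. x \<notin> (\<Union>i\<in>N. {s i<..<t i}) \<longrightarrow> curve K x = curve K' x) \<and>
        (\<forall>x. x \<notin> (\<Union>i\<in>N. {s i..t i}) \<longrightarrow> (x \<in> over K \<longleftrightarrow> x \<in> over K')) \<and>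
        (\<forall>i\<in>N. continuous_on {s i..t i} (\<psi> i) \<and> bij_betw (\<psi> i) {s i..t i} {-2..2} \<and>
               (\<forall>x\<in>{s i..t i}. curve K x = e ((P ! i) (\<psi> i x)))) \<and>
        (\<forall>i\<in>N. continuous_on {s i..t i} (\<psi>' i) \<and> bij_betw (\<psi>' i) {s i..t i} {-2..2} \<and>
               (\<forall>x\<in>{s i..t i}. curve K' x = e' ((P' ! i) (\<psi>' i x)))) \<and>
        inj_on h N \<and>
        (\<forall>i\<in>N. \<forall>j\<in>N. \<forall>x\<in>{s i..t i}. \<forall>y\<in>{s j..t j}. h j < h i \<longrightarrow>
               (curve K x = curve K y \<longrightarrow> x \<in> over K) \<and>
               (curve K' x = curve K' y \<longrightarrow> x \<in> over K')))"

text \<open>\<open>R1\<close>: a straight arc, and an arc with one kink (a nodal cubic, with its node at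
  \<open>\<tau> = 1\<close> and \<open>\<tau> = -1\<close>).\<close>

definition R1 :: "diagram \<Rightarrow> diagram \<Rightarrow> bool" where
  "R1 = local_move
     [\<lambda>\<tau>. (\<tau>, 3)]
     [\<lambda>\<tau>. ((\<tau>^3 - \<tau>) / 3, \<tau>^2 - 1)]"

text \<open>\<open>R2\<close>: two disjoint arcs, and two arcs forming a bigon with vertices \<open>(1, 0)\<close> and
  \<open>(-1, 0)\<close>.\<close>

definition R2 :: "diagram \<Rightarrow> diagram \<Rightarrow> bool" where
  "R2 = local_move
     [\<lambda>\<tau>. (\<tau>, 3), \<lambda>\<tau>. (\<tau>, -3)]
     [\<lambda>\<tau>. (\<tau>, \<tau>^2 - 1), \<lambda>\<tau>. (\<tau>, 1 - \<tau>^2)]"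

text \<open>\<open>R3\<close>: two straight arcs crossing at the origin, and a third arc passing above, respectively
  below, the origin and crossing each of them once.\<close>

definition R3 :: "diagram \<Rightarrow> diagram \<Rightarrow> bool" where
  "R3 = local_move
     [\<lambda>\<tau>. (\<tau>, \<tau>), \<lambda>\<tau>. (\<tau>, -\<tau>), \<lambda>\<tau>. (\<tau>, (4 - \<tau>^2) / 3)]
     [\<lambda>\<tau>. (\<tau>, \<tau>), \<lambda>\<tau>. (\<tau>, -\<tau>), \<lambda>\<tau>. (\<tau>, -((4 - \<tau>^2) / 3))]"

definition diagram_step :: "complex \<Rightarrow> diagram \<Rightarrow> diagram \<Rightarrow> bool" where
  "diagram_step pt K K' \<longleftrightarrow>
     long_knot_diagram pt K \<and> long_knot_diagram pt K' \<and>
     (planar_isotopic K K' \<or> R1 K K' \<or> R2 K K' \<or> R3 K K')"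

text \<open>The equivalence closure allows finitely many steps, each in either direction.\<close>

definition equivalent_diagrams :: "complex \<Rightarrow> diagram \<Rightarrow> diagram \<Rightarrow> bool" where
  "equivalent_diagrams pt = equivclp (diagram_step pt)"

end

theory Submission
  imports Defs
begin

text \<open>In \<open>G''\<close> the primed generators are redundant, \<open>b' = a b\<inverse> a\<close> and \<open>c' = a c\<inverse> a\<close>, and
  changing both the type and the parity of the position of an odd endpoint conjugates its letter
  by \<open>a\<close>. A first move adds an isolated, hence even, chord, and \<open>a a = 1\<close>. A second move adds two
  chords of equal parity and type whose endpoints are adjacent in pairs, so their letters cancel.
  In a third move every other chord is linked with an even number of the three chords involved, so
  an even number of these is odd. The move switches the linking of any two of them, so their
  parities are preserved, the odd ones change their type, and all their endpoints change the
  parity of their position. What remains is the identity \<open>u v = a v u a\<close> for the letters of two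
  adjacent odd endpoints, a consequence of the relations. Nothing about the cylinder is used
  beyond the effect of the moves on Gauss diagrams.\<close>

section \<open>Letters in \<open>G''\<close>\<close>

text \<open>A local picture fixes neither the directions of its arcs, nor the order in which they
  lie along the line, nor which of them is higher, so a list of oriented moves would be long. It is
  avoided by extracting little from a picture: which arcs meet at each crossing, which of them is
  over, and how the orders of the crossings on an arc before and after the move compare. Linking is
  written as an exclusive or of order comparisons. In this form it is additive modulo 2, and
  reversing two neighbouring endpoints changes exactly one comparison, so the arrangement of the
  arcs on the line never has to be distinguished. The price is paid in the group:
  \<open>u v = a v u a\<close> is needed for all choices of over and under, of types, and of the
  parity of the position. After the primed generators are eliminated, the relation
  \<open>c b^{-1} = b' c'^{-1}\<close> is the single instance for \<open>c\<close> and
  \<open>b^{-1}\<close>; apart from the trivial case of mutually inverse letters, the other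
  instances follow from it by the symmetries of the identity.\<close>

locale involution_group = group +
  fixes a
  assumes a_closed [simp]: "a \<in> carrier G"
    and a_square: "a \<otimes> a = \<one>"
begin

text \<open>Conjugation by \<open>a\<close> takes \<open>v u\<close> to \<open>u v\<close>. The
  relation is stable under exchanging the arguments, under inverting and exchanging them, and under
  replacing one argument \<open>x\<close> by \<open>a (inv x) a\<close>, which is the passage from
  an unprimed to a primed generator. One instance therefore yields a whole family.\<close>

definition twisted_commute :: "'a \<Rightarrow> 'a \<Rightarrow> bool" where
  "twisted_commute u v \<longleftrightarrow> u \<otimes> v = a \<otimes> (v \<otimes> (u \<otimes> a))"

lemma a_cancel [simp]: "x \<in> carrier G \<Longrightarrow> a \<otimes> (a \<otimes> x) = x"
  by (simp add: a_square flip: m_assoc)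

lemma inv_a [simp]: "inv a = a"
  using a_square by (simp add: inv_equality)

lemma inv_cancel [simp]:
  assumes "x \<in> carrier G" "y \<in> carrier G"
  shows "x \<otimes> (inv x \<otimes> y) = y" "inv x \<otimes> (x \<otimes> y) = y"
  using assms by (simp_all flip: m_assoc)

lemma twisted_commute_sym:
  assumes "twisted_commute u v" and [simp]: "u \<in> carrier G" "v \<in> carrier G"
  shows "twisted_commute v u"
proof -
  have "a \<otimes> ((u \<otimes> v) \<otimes> a) = a \<otimes> ((a \<otimes> (v \<otimes> (u \<otimes> a))) \<otimes> a)"
    using assms(1) by (simp add: twisted_commute_def)
  then show ?thesis
    by (simp add: twisted_commute_def a_square m_assoc)
qed

lemma twisted_commute_inv:
  assumes "twisted_commute u v" and [simp]: "u \<in> carrier G" "v \<in> carrier G"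
  shows "twisted_commute (inv v) (inv u)"
proof -
  have "inv (u \<otimes> v) = inv (a \<otimes> (v \<otimes> (u \<otimes> a)))"
    using assms(1) by (simp add: twisted_commute_def)
  then show ?thesis
    by (simp add: twisted_commute_def inv_mult_group m_assoc)
qed

text \<open>Solve the hypothesis for \<open>u a\<close>, then multiply by \<open>inv v a\<close> on
  the right.\<close>

lemma twisted_commute_flip_right:
  assumes "twisted_commute u v" and [simp]: "u \<in> carrier G" "v \<in> carrier G"
  shows "twisted_commute u (a \<otimes> (inv v \<otimes> a))"
proof -
  have "inv v \<otimes> (a \<otimes> (u \<otimes> v)) = u \<otimes> a"
    using assms(1) by (simp add: twisted_commute_def a_square m_assoc)
  then have "inv v \<otimes> (a \<otimes> (u \<otimes> v)) \<otimes> (inv v \<otimes> a) = u \<otimes> a \<otimes> (inv v \<otimes> a)"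
    by simp
  then show ?thesis
    by (simp add: twisted_commute_def m_assoc)
qed

lemma twisted_commute_flip_left:
  assumes "twisted_commute u v" and [simp]: "u \<in> carrier G" "v \<in> carrier G"
  shows "twisted_commute (a \<otimes> (inv u \<otimes> a)) v"
  using assms by (simp add: twisted_commute_sym twisted_commute_flip_right)

end

lemma word_class_closed [simp]: "word_class R u \<in> carrier (presented_group R)"
  by (simp add: presented_group_def)

lemma gen_closed [simp]: "gen R x \<in> carrier (presented_group R)"
  by (simp add: gen_def)

lemma one_presented_group: "\<one>\<^bsub>presented_group R\<^esub> = word_class R []"
  by (simp add: presented_group_def)

lemma inv_gen: "inv\<^bsub>presented_group R\<^esub> (gen R x) = word_class R [(x, False)]"
proof -
  interpret group "presented_group R" by (rule presented_group_is_group)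
  show ?thesis
    using word_eq.cancel[of R x False]
    by (intro inv_equality)
       (simp_all add: gen_def presented_group_mult one_presented_group word_class_eq_iff)
qed

lemma presented_group_relation:
  "(u, v) \<in> R \<Longrightarrow> word_class R u = word_class R v"
  by (simp add: word_class_eq_iff word_eq.relation)

lemma gen_G2_closed [simp]: "gen G2_rels x \<in> carrier G2"
  by (simp add: G2_def)

lemma G2_relations:
  "gen G2_rels Ga \<otimes>\<^bsub>G2\<^esub> gen G2_rels Ga = \<one>\<^bsub>G2\<^esub>"
  "gen G2_rels Ga \<otimes>\<^bsub>G2\<^esub> gen G2_rels Gb = inv\<^bsub>G2\<^esub> (gen G2_rels Gb') \<otimes>\<^bsub>G2\<^esub> gen G2_rels Ga"
  "gen G2_rels Ga \<otimes>\<^bsub>G2\<^esub> gen G2_rels Gc = inv\<^bsub>G2\<^esub> (gen G2_rels Gc') \<otimes>\<^bsub>G2\<^esub> gen G2_rels Ga"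
  "gen G2_rels Gc \<otimes>\<^bsub>G2\<^esub> inv\<^bsub>G2\<^esub> (gen G2_rels Gb) = gen G2_rels Gb' \<otimes>\<^bsub>G2\<^esub> inv\<^bsub>G2\<^esub> (gen G2_rels Gc')"
  unfolding G2_def inv_gen unfolding gen_def presented_group_mult one_presented_group
  by (rule presented_group_relation; simp add: G2_rels_def)+

interpretation G2: involution_group G2 "gen G2_rels Ga"
  by (intro involution_group.intro involution_group_axioms.intro)
     (simp_all add: G2_relations, simp add: G2_def presented_group_is_group)

text \<open>Both relations have the form \<open>a x = (inv y) a\<close>. Inverting the two sides
  gives \<open>(inv x) a = a y\<close>, because \<open>a\<close> is its own inverse.\<close>

lemma conj_b: "gen G2_rels Gb' = gen G2_rels Ga \<otimes>\<^bsub>G2\<^esub> (inv\<^bsub>G2\<^esub> (gen G2_rels Gb) \<otimes>\<^bsub>G2\<^esub> gen G2_rels Ga)"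
  and conj_c: "gen G2_rels Gc' = gen G2_rels Ga \<otimes>\<^bsub>G2\<^esub> (inv\<^bsub>G2\<^esub> (gen G2_rels Gc) \<otimes>\<^bsub>G2\<^esub> gen G2_rels Ga)"
proof -
  have *: "y = a \<otimes>\<^bsub>G2\<^esub> (inv\<^bsub>G2\<^esub> x \<otimes>\<^bsub>G2\<^esub> a)"
    if "a \<otimes>\<^bsub>G2\<^esub> x = inv\<^bsub>G2\<^esub> y \<otimes>\<^bsub>G2\<^esub> a" "a = gen G2_rels Ga"
      and [simp]: "x \<in> carrier G2" "y \<in> carrier G2" for a x y
  proof -
    have "inv\<^bsub>G2\<^esub> (a \<otimes>\<^bsub>G2\<^esub> x) = inv\<^bsub>G2\<^esub> (inv\<^bsub>G2\<^esub> y \<otimes>\<^bsub>G2\<^esub> a)"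
      using that(1) by simp
    then have "inv\<^bsub>G2\<^esub> x \<otimes>\<^bsub>G2\<^esub> a = a \<otimes>\<^bsub>G2\<^esub> y"
      by (simp add: that(2) G2.inv_mult_group)
    then show ?thesis
      by (simp add: that(2))
  qed
  show "gen G2_rels Gb' = gen G2_rels Ga \<otimes>\<^bsub>G2\<^esub> (inv\<^bsub>G2\<^esub> (gen G2_rels Gb) \<otimes>\<^bsub>G2\<^esub> gen G2_rels Ga)"
    "gen G2_rels Gc' = gen G2_rels Ga \<otimes>\<^bsub>G2\<^esub> (inv\<^bsub>G2\<^esub> (gen G2_rels Gc) \<otimes>\<^bsub>G2\<^esub> gen G2_rels Ga)"
    by (rule *; simp add: G2_relations)+
qed

text \<open>Substituting for the primed generators turns \<open>b' c'^{-1}\<close> into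
  \<open>(a b^{-1} a) (a c a)\<close>, and the two inner factors \<open>a\<close> cancel.\<close>

lemma twisted_commute_c_b: "G2.twisted_commute (gen G2_rels Gc) (inv\<^bsub>G2\<^esub> (gen G2_rels Gb))"
proof -
  let ?a = "gen G2_rels Ga" and ?b = "gen G2_rels Gb" and ?c = "gen G2_rels Gc"
  have "?c \<otimes>\<^bsub>G2\<^esub> inv\<^bsub>G2\<^esub> ?b = ?a \<otimes>\<^bsub>G2\<^esub> (inv\<^bsub>G2\<^esub> ?b \<otimes>\<^bsub>G2\<^esub> (?c \<otimes>\<^bsub>G2\<^esub> ?a))"
    unfolding G2_relations(4) conj_b conj_c by (simp add: G2.inv_mult_group G2.m_assoc)
  then show ?thesis by (simp add: G2.twisted_commute_def)
qed

text \<open>Detached from any diagram, so that the identities between letters are pure group theory.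
  For an even chord the last three flags are ignored.\<close>

definition letter :: "bool \<Rightarrow> bool \<Rightarrow> bool \<Rightarrow> bool \<Rightarrow> generator word set" where
  "letter even_ch over_end first even_pos =
     (if even_ch then gen G2_rels Ga
      else let g = gen G2_rels (if over_end then if first then Gb else Gb'
                                else if first then Gc else Gc')
           in if even_pos then g else inv\<^bsub>G2\<^esub> g)"

lemma letter_closed [simp]: "letter e w f p \<in> carrier G2"
  by (simp add: letter_def Let_def)

lemma letter_even [simp]: "letter True w f p = gen G2_rels Ga"
  by (simp add: letter_def)

lemma letter_adjacent: "letter e w f p \<otimes>\<^bsub>G2\<^esub> letter e w f (\<not> p) = \<one>\<^bsub>G2\<^esub>"
  by (simp add: letter_def Let_def G2_relations)

lemma letter_conj:
  "letter False w (\<not> f) (\<not> p) = gen G2_rels Ga \<otimes>\<^bsub>G2\<^esub> (letter False w f p \<otimes>\<^bsub>G2\<^esub> gen G2_rels Ga)"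
  by (simp add: letter_def Let_def conj_b conj_c G2.inv_mult_group G2.m_assoc G2.a_square)

text \<open>For two over-endpoints or two under-endpoints the letters are mutually inverse and both
  sides are trivial. The mixed cases are the instance for \<open>c\<close> and \<open>b^{-1}\<close>
  and its inverted form for \<open>b\<close> and \<open>c^{-1}\<close>.\<close>

lemma twisted_commute_letter_first:
  "G2.twisted_commute (letter False w True True) (letter False w' True False)"
proof -
  have "G2.twisted_commute x (inv\<^bsub>G2\<^esub> x)" if "x \<in> carrier G2" for x
    using that by (simp add: G2.twisted_commute_def G2.a_square)
  moreover have "G2.twisted_commute (gen G2_rels Gb) (inv\<^bsub>G2\<^esub> (gen G2_rels Gc))"
    using G2.twisted_commute_inv[OF twisted_commute_c_b] by simp
  ultimately show ?thesis
    using twisted_commute_c_b by (simp add: letter_def)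
qed

lemma twisted_commute_letter:
  "G2.twisted_commute (letter False w f p) (letter False w' f' (\<not> p))"
proof -
  have inv_letter: "inv\<^bsub>G2\<^esub> (letter False w f p) = letter False w f (\<not> p)" for w f p
    by (simp add: letter_def Let_def)
  \<comment> \<open>A letter of the second type arises from the first-type letter in the same
    position by \<open>x\<close> to \<open>a (inv x) a\<close>, so each argument can be reduced to
    the first type separately.\<close>
  have second: "letter False w False p
      = gen G2_rels Ga \<otimes>\<^bsub>G2\<^esub> (inv\<^bsub>G2\<^esub> (letter False w True p) \<otimes>\<^bsub>G2\<^esub> gen G2_rels Ga)" for w p
    using letter_conj[of w True "\<not> p"] by (simp add: inv_letter)
  have even_pos: "G2.twisted_commute (letter False w f True) (letter False w' f' False)" for w w' f f'
    using twisted_commute_letter_first[of w w']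
    by (cases f; cases f';
        simp add: second G2.twisted_commute_flip_left G2.twisted_commute_flip_right)
  then show ?thesis
    using G2.twisted_commute_sym[OF even_pos[of w' f' w f]] by (cases p) simp_all
qed

text \<open>Only the type of an odd chord matters, and it changes in a third Reidemeister move.\<close>

lemma letter_swap:
  assumes "\<not> e \<Longrightarrow> g = (\<not> f)" "\<not> e' \<Longrightarrow> g' = (\<not> f')"
  shows "letter e w f p \<otimes>\<^bsub>G2\<^esub> letter e' w' f' (\<not> p) = letter e' w' g' p \<otimes>\<^bsub>G2\<^esub> letter e w g (\<not> p)"
proof (cases "e \<or> e'")
  \<comment> \<open>The letter of an even chord is \<open>a\<close>, and moving \<open>a\<close>
    past the other letter is the conjugation in \<open>letter_conj\<close>.\<close>
  case True
  then show ?thesis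
    using assms letter_conj[of w f p] letter_conj[of w' f' "\<not> p"]
    by (cases e; cases e') (simp_all add: G2_relations G2.m_assoc)
next
  case False
  then have "e = False" "e' = False" "g = (\<not> f)" "g' = (\<not> f')" using assms by auto
  then show ?thesis
    using twisted_commute_letter[of w f p w' f'] letter_conj[of w f p] letter_conj[of w' f' "\<not> p"]
    by (simp add: G2.twisted_commute_def G2.m_assoc)
qed

section \<open>Products over finite sets of reals\<close>

definition ordered_prod :: "(real \<Rightarrow> generator word set) \<Rightarrow> real set \<Rightarrow> generator word set" where
  "ordered_prod f A = foldr (\<lambda>x g. f x \<otimes>\<^bsub>G2\<^esub> g) (sorted_list_of_set A) \<one>\<^bsub>G2\<^esub>"

lemma foldr_mult_closed:
  "(\<And>x. x \<in> set xs \<Longrightarrow> f x \<in> carrier G2) \<Longrightarrow>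
    foldr (\<lambda>x g. f x \<otimes>\<^bsub>G2\<^esub> g) xs \<one>\<^bsub>G2\<^esub> \<in> carrier G2"
  by (induction xs) auto

lemma foldr_mult_append:
  assumes "\<And>x. x \<in> set xs \<union> set ys \<Longrightarrow> f x \<in> carrier G2"
  shows "foldr (\<lambda>x g. f x \<otimes>\<^bsub>G2\<^esub> g) (xs @ ys) \<one>\<^bsub>G2\<^esub>
    = foldr (\<lambda>x g. f x \<otimes>\<^bsub>G2\<^esub> g) xs \<one>\<^bsub>G2\<^esub> \<otimes>\<^bsub>G2\<^esub> foldr (\<lambda>x g. f x \<otimes>\<^bsub>G2\<^esub> g) ys \<one>\<^bsub>G2\<^esub>"
  using assms by (induction xs) (auto simp: foldr_mult_closed G2.m_assoc)

lemma ordered_prod_closed [simp]: "(\<And>x. f x \<in> carrier G2) \<Longrightarrow> ordered_prod f A \<in> carrier G2"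
  unfolding ordered_prod_def by (rule foldr_mult_closed)

lemma ordered_prod_empty [simp]: "ordered_prod f {} = \<one>\<^bsub>G2\<^esub>"
  by (simp add: ordered_prod_def)

lemma ordered_prod_cong:
  assumes "A = B" "\<And>x. x \<in> B \<Longrightarrow> f x = g x"
  shows "ordered_prod f A = ordered_prod g B"
proof (cases "finite B")
  case True
  then show ?thesis
    unfolding ordered_prod_def assms(1) by (intro foldr_cong) (simp_all add: assms(2))
\<comment> \<open>The sorted list of an infinite set is empty by convention, so both products are
  the unit.\<close>
qed (simp add: assms(1) ordered_prod_def)

lemma ordered_prod_union:
  assumes "finite A" "finite B" "\<And>x y. x \<in> A \<Longrightarrow> y \<in> B \<Longrightarrow> x < y" "\<And>x. f x \<in> carrier G2"
  shows "ordered_prod f (A \<union> B) = ordered_prod f A \<otimes>\<^bsub>G2\<^esub> ordered_prod f B"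
proof -
  have "sorted_list_of_set (A \<union> B) = sorted_list_of_set A @ sorted_list_of_set B"
    using assms(1-3)
    by (intro sorted_distinct_set_unique)
       (fastforce simp: sorted_append intro: less_imp_le)+
  then show ?thesis
    unfolding ordered_prod_def by (simp only:) (rule foldr_mult_append, rule assms(4))
qed

lemma ordered_prod_singleton: "(\<And>x. f x \<in> carrier G2) \<Longrightarrow> ordered_prod f {u} = f u"
  by (simp add: ordered_prod_def)

lemma ordered_prod_pair:
  "u < v \<Longrightarrow> (\<And>x. f x \<in> carrier G2) \<Longrightarrow> ordered_prod f {u, v} = f u \<otimes>\<^bsub>G2\<^esub> f v"
  using ordered_prod_union[of "{u}" "{v}" f] by (simp add: ordered_prod_singleton insert_commute)

lemma ordered_prod_image:
  assumes "strict_mono_on A r" "finite A" "\<And>x. f x \<in> carrier G2"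
  shows "ordered_prod f (r ` A) = ordered_prod (f \<circ> r) A"
proof -
  have "sorted_list_of_set (r ` A) = map r (sorted_list_of_set A)"
    using assms(1,2) strict_mono_on_imp_inj_on[OF assms(1)]
    by (intro sorted_distinct_set_unique)
       (auto simp: distinct_map sorted_map intro!: sorted_wrt_mono_rel[OF _ sorted_sorted_list_of_set]
          dest: strict_mono_on_leD)
  then show ?thesis
    by (simp add: ordered_prod_def foldr_map comp_def)
qed

text \<open>Cut the product at the interval into the factors before, inside and after; only the
  middle factor is exchanged. If \<open>t < s\<close> the interval is empty and the two sets
  coincide.\<close>

lemma ordered_prod_replace:
  assumes "finite A" "finite B" and f: "\<And>x. f x \<in> carrier G2" and g: "\<And>x. g x \<in> carrier G2"
    and outside: "A - {s..t} = B - {s..t}" "\<And>x. x \<in> A - {s..t} \<Longrightarrow> f x = g x"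
    and inside: "ordered_prod f (A \<inter> {s..t}) = ordered_prod g (B \<inter> {s..t})"
  shows "ordered_prod f A = ordered_prod g B"
proof (cases "s \<le> t")
  case True
  have split: "ordered_prod f A = ordered_prod f {x \<in> A - {s..t}. x < s}
      \<otimes>\<^bsub>G2\<^esub> ordered_prod f (A \<inter> {s..t}) \<otimes>\<^bsub>G2\<^esub> ordered_prod f {x \<in> A - {s..t}. t < x}"
    if [simp]: "finite A" "\<And>x. f x \<in> carrier G2" for f A
  proof -
    have "A = {x \<in> A - {s..t}. x < s} \<union> A \<inter> {s..t} \<union> {x \<in> A - {s..t}. t < x}"
      by auto
    then have "ordered_prod f A
        = ordered_prod f ({x \<in> A - {s..t}. x < s} \<union> A \<inter> {s..t} \<union> {x \<in> A - {s..t}. t < x})"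
      by simp
    also have "\<dots> = ordered_prod f ({x \<in> A - {s..t}. x < s} \<union> A \<inter> {s..t})
        \<otimes>\<^bsub>G2\<^esub> ordered_prod f {x \<in> A - {s..t}. t < x}"
      using True by (intro ordered_prod_union) auto
    also have "ordered_prod f ({x \<in> A - {s..t}. x < s} \<union> A \<inter> {s..t})
        = ordered_prod f {x \<in> A - {s..t}. x < s} \<otimes>\<^bsub>G2\<^esub> ordered_prod f (A \<inter> {s..t})"
      by (intro ordered_prod_union) auto
    finally show ?thesis .
  qed
  have "ordered_prod f {x \<in> A - {s..t}. P x} = ordered_prod g {x \<in> B - {s..t}. P x}" for P
    by (rule ordered_prod_cong) (use outside in auto)
  then show ?thesis
    using split[of A f] split[of B g] assms by simp
next
  case False
  then show ?thesis using assms by (intro ordered_prod_cong) auto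
qed

lemma ordered_prod_replace_intervals:
  assumes "finite N" "finite A" "finite B"
    and f: "\<And>x. f x \<in> carrier G2" and g: "\<And>x. g x \<in> carrier G2"
    and disjoint: "\<And>i j. i \<in> N \<Longrightarrow> j \<in> N \<Longrightarrow> i \<noteq> j \<Longrightarrow> {s i..t i} \<inter> {s j..t j} = {}"
    and outside: "A - (\<Union>i\<in>N. {s i..t i}) = B - (\<Union>i\<in>N. {s i..t i})"
      "\<And>x. x \<in> A - (\<Union>i\<in>N. {s i..t i}) \<Longrightarrow> f x = g x"
    and inside: "\<And>i. i \<in> N \<Longrightarrow>
      ordered_prod f (A \<inter> {s i..t i}) = ordered_prod g (B \<inter> {s i..t i})"
  shows "ordered_prod f A = ordered_prod g B"
  using assms(1-3) f disjoint outside inside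
proof (induction N arbitrary: A f)
  case empty
  then show ?case by (intro ordered_prod_cong) auto
next
  case (insert k N)
  let ?I = "{s k..t k}"
  \<comment> \<open>A hybrid of the two sides: \<open>B\<close> and \<open>g\<close> on the interval
    of \<open>k\<close>, and \<open>A\<close> and \<open>f\<close> elsewhere. As the intervals are
    disjoint, the remaining ones still carry the original data.\<close>
  define A1 where "A1 = A - ?I \<union> B \<inter> ?I"
  define f1 where "f1 x = (if x \<in> ?I then g x else f x)" for x
  have away: "{s i..t i} \<inter> ?I = {}" if "i \<in> N" for i
    using insert.hyps(2) insert.prems(4)[of i k] that by auto
  have "ordered_prod f A = ordered_prod f1 A1"
  proof (rule ordered_prod_replace)
    show "ordered_prod f (A \<inter> ?I) = ordered_prod f1 (A1 \<inter> ?I)"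
      using insert.prems(7)[of k]
      by (auto simp: A1_def f1_def intro!: ordered_prod_cong)
  qed (use insert.prems g in \<open>auto simp: A1_def f1_def\<close>)
  also have "\<dots> = ordered_prod g B"
  proof (rule insert.IH)
    show "ordered_prod f1 (A1 \<inter> {s i..t i}) = ordered_prod g (B \<inter> {s i..t i})" if "i \<in> N" for i
    proof -
      have "ordered_prod f1 (A1 \<inter> {s i..t i}) = ordered_prod f (A \<inter> {s i..t i})"
        using away[OF that] by (intro ordered_prod_cong) (auto simp: A1_def f1_def)
      then show ?thesis using insert.prems(7)[of i] that by simp
    qed
    show "A1 - (\<Union>i\<in>N. {s i..t i}) = B - (\<Union>i\<in>N. {s i..t i})"
      using insert.prems(5) away by (auto simp: A1_def)
    show "f1 x = g x" if "x \<in> A1 - (\<Union>i\<in>N. {s i..t i})" for x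
      using insert.prems(6)[of x] that by (auto simp: A1_def f1_def)
  qed (use insert.prems g in \<open>auto simp: A1_def f1_def\<close>)
  finally show ?case .
qed

section \<open>Gauss diagrams\<close>

text \<open>Disjointness of the chords makes the description in \<open>chord_at\<close> unique; for
  a curve it expresses the absence of triple points.\<close>

definition gauss_like :: "chord set \<Rightarrow> bool" where
  "gauss_like G \<longleftrightarrow> finite G \<and> (\<forall>c\<in>G. fst c \<noteq> snd c) \<and>
     (\<forall>c\<in>G. \<forall>d\<in>G. c \<noteq> d \<longrightarrow> {fst c, snd c} \<inter> {fst d, snd d} = {})"

lemma finite_endpoints: "gauss_like G \<Longrightarrow> finite (endpoints G)"
  by (simp add: gauss_like_def endpoints_def)

lemma endpoints_Un: "endpoints (A \<union> B) = endpoints A \<union> endpoints B"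
  by (auto simp: endpoints_def)

lemma chord_at_eq:
  assumes "gauss_like G" "c \<in> G" "x = fst c \<or> x = snd c"
  shows "chord_at G x = c"
  unfolding chord_at_def
proof (rule the_equality)
  show "d = c" if "d \<in> G \<and> (x = fst d \<or> x = snd d)" for d
    using assms that unfolding gauss_like_def by (metis IntI empty_iff insertCI)
qed (use assms in simp)

lemma endpoint_letter_closed [simp]: "endpoint_letter G x \<in> carrier G2"
  by (simp add: endpoint_letter_def signed_gen_def Let_def)

lemma gauss_phi_ordered_prod: "gauss_phi G = ordered_prod (endpoint_letter G) (endpoints G)"
  by (simp add: gauss_phi_def ordered_prod_def)

text \<open>A chord with endpoints \<open>x\<close> and \<open>y\<close>; the flag says whether \<open>x\<close> is the over-endpoint.\<close>

definition mk_chord :: "bool \<Rightarrow> real \<Rightarrow> real \<Rightarrow> chord" where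
  "mk_chord w x y = (if w then (x, y) else (y, x))"

lemma endpoint_letter_chord:
  assumes "gauss_like G" "mk_chord w x y \<in> G"
  shows "endpoint_letter G x = letter (even_chord G (mk_chord w x y)) w
      (first_type G (mk_chord w x y)) (even (position G x))"
    and "endpoint_letter G y = letter (even_chord G (mk_chord w x y)) (\<not> w)
      (first_type G (mk_chord w x y)) (even (position G y))"
proof -
  have "x \<noteq> y"
    using assms by (auto simp: gauss_like_def mk_chord_def split: if_splits)
  moreover have "chord_at G x = mk_chord w x y" "chord_at G y = mk_chord w x y"
    using assms by (auto intro!: chord_at_eq simp: mk_chord_def)
  ultimately show "endpoint_letter G x = letter (even_chord G (mk_chord w x y)) w
      (first_type G (mk_chord w x y)) (even (position G x))"
    and "endpoint_letter G y = letter (even_chord G (mk_chord w x y)) (\<not> w)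
      (first_type G (mk_chord w x y)) (even (position G y))"
    by (auto simp: endpoint_letter_def letter_def signed_gen_def Let_def mk_chord_def)
qed

section \<open>Linking and counting modulo 2\<close>

declare linked.simps [simp del]

lemma linked_commute: "linked c d \<longleftrightarrow> linked d c"
  by (cases c; cases d) (simp only: linked.simps, rule disj_commute)

lemma not_linked_self [simp]: "\<not> linked c c"
  by (cases c) (simp add: linked.simps)

lemma linked_swap_ends: "linked (x, y) d \<longleftrightarrow> linked (y, x) d"
  by (cases d) (simp add: linked.simps min.commute max.commute)

text \<open>\<open>(p < r) \<noteq> (p < s)\<close> says that \<open>p\<close> lies between
  \<open>r\<close> and \<open>s\<close>, and the chords are linked when exactly one of
  \<open>p\<close> and \<open>q\<close> does. This replaces \<open>min\<close> and
  \<open>max\<close> by a sum modulo 2 of four comparisons.\<close>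

lemma linked_xor:
  assumes "distinct [p, q, r, s]"
  shows "linked (p, q) (r, s) \<longleftrightarrow> (((p < r) \<noteq> (p < s)) \<noteq> ((q < r) \<noteq> (q < s)))"
proof -
  have *: "linked (p, q) (r, s) \<longleftrightarrow> (((p < r) \<noteq> (p < s)) \<noteq> ((q < r) \<noteq> (q < s)))"
    if "p < q" "r < s" "distinct [p, q, r, s]" for p q r s
    using that by (auto simp: linked.simps)
  have "linked (p, q) (r, s) = linked (q, p) (r, s)" "linked (p, q) (r, s) = linked (p, q) (s, r)"
    "linked (p, q) (r, s) = linked (q, p) (s, r)"
    by (simp_all add: linked.simps min.commute max.commute)
  then show ?thesis
    using assms *[of p q r s] *[of q p r s] *[of p q s r] *[of q p s r]
    by (cases "p < q"; cases "r < s") (simp_all, argo+)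
qed
lemma linked_mk_chord [simp]:
  "linked (mk_chord w x y) = linked (x, y)" "linked d (mk_chord w x y) = linked d (x, y)"
  by (simp_all add: fun_eq_iff mk_chord_def linked_swap_ends[of y x] linked_commute[of d])

text \<open>The parity of a cardinality as a truth value: addition modulo 2 becomes
  \<open>\<noteq>\<close> on booleans, which propositional reasoning handles.\<close>

definition odd_count :: "'a set \<Rightarrow> ('a \<Rightarrow> bool) \<Rightarrow> bool" where
  "odd_count A P \<longleftrightarrow> odd (card {x \<in> A. P x})"

lemma odd_count_empty [simp]: "\<not> odd_count {} P"
  by (simp add: odd_count_def)

lemma odd_count_insert:
  assumes "finite A" "x \<notin> A"
  shows "odd_count (insert x A) P \<longleftrightarrow> (P x \<noteq> odd_count A P)"
proof -
  have "{y \<in> insert x A. P y} = (if P x then insert x {y \<in> A. P y} else {y \<in> A. P y})"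
    by auto
  then show ?thesis using assms by (simp add: odd_count_def)
qed

lemma odd_count_Un:
  assumes "finite A" "finite B" "A \<inter> B = {}"
  shows "odd_count (A \<union> B) P \<longleftrightarrow> (odd_count A P \<noteq> odd_count B P)"
proof -
  have "{x \<in> A \<union> B. P x} = {x \<in> A. P x} \<union> {x \<in> B. P x}" by auto
  moreover have "card \<dots> = card {x \<in> A. P x} + card {x \<in> B. P x}"
    using assms by (intro card_Un_disjoint) auto
  ultimately show ?thesis by (simp add: odd_count_def)
qed

lemma odd_count_cong:
  "(\<And>x. x \<in> A \<Longrightarrow> P x = Q x) \<Longrightarrow> odd_count A P = odd_count A Q"
  unfolding odd_count_def by (metis (mono_tags, lifting) Collect_cong)

lemma odd_count_xor:
  "finite A \<Longrightarrow> odd_count A (\<lambda>x. P x \<noteq> Q x) = (odd_count A P \<noteq> odd_count A Q)"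
  by (induction A rule: finite_induct) (auto simp: odd_count_insert)

lemma even_chord_odd_count: "even_chord G c \<longleftrightarrow> \<not> odd_count G (linked c)"
  by (simp add: even_chord_def odd_count_def)

lemma first_type_odd_count:
  "\<not> even_chord G c \<Longrightarrow>
    first_type G c \<longleftrightarrow> \<not> odd_count G (\<lambda>d. even_chord G d \<and> linked c d)"
  by (simp add: first_type_def odd_chord_def even_chord_def odd_count_def)

section \<open>Parities of positions and of chords under a local change\<close>

lemma even_position_parity:
  assumes "finite N" "finite (endpoints C)" "finite (endpoints M)"
    and disjoint: "\<And>i j. i \<in> N \<Longrightarrow> j \<in> N \<Longrightarrow> i \<noteq> j \<Longrightarrow> {s i..t i} \<inter> {s j..t j} = {}"
    and C: "endpoints C \<inter> (\<Union>i\<in>N. {s i..t i}) = {}" and M: "endpoints M \<subseteq> (\<Union>i\<in>N. {s i..t i})"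
    and ev: "\<And>i. i \<in> N \<Longrightarrow> even (card (endpoints M \<inter> {s i..t i}))"
  shows even_position_outside: "x \<notin> (\<Union>i\<in>N. {s i..t i}) \<Longrightarrow>
      even (position (C \<union> M) x) \<longleftrightarrow> even (card {y \<in> endpoints C. y \<le> x})"
    and even_position_inside: "k \<in> N \<Longrightarrow> x \<in> {s k..t k} \<Longrightarrow>
      even (position (C \<union> M) x) \<longleftrightarrow>
      even (card {y \<in> endpoints C. y \<le> x} + card {y \<in> endpoints M \<inter> {s k..t k}. y \<le> x})"
proof -
  let ?E = "\<lambda>i. {y \<in> endpoints M \<inter> {s i..t i}. y \<le> x}"
  have "{y \<in> endpoints (C \<union> M). y \<le> x} = {y \<in> endpoints C. y \<le> x} \<union> (\<Union>i\<in>N. ?E i)"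
    using M unfolding endpoints_Un by blast
  moreover have "card ({y \<in> endpoints C. y \<le> x} \<union> (\<Union>i\<in>N. ?E i))
      = card {y \<in> endpoints C. y \<le> x} + card (\<Union>i\<in>N. ?E i)"
  proof (rule card_Un_disjoint)
    show "{y \<in> endpoints C. y \<le> x} \<inter> (\<Union>i\<in>N. ?E i) = {}" using C by blast
  qed (use assms(1-3) in auto)
  moreover have "card (\<Union>i\<in>N. ?E i) = (\<Sum>i\<in>N. card (?E i))"
  proof (rule card_UN_disjoint)
    show "\<forall>i\<in>N. \<forall>j\<in>N. i \<noteq> j \<longrightarrow> ?E i \<inter> ?E j = {}" using disjoint by blast
  qed (use assms(1,3) in simp_all)
  ultimately have pos: "position (C \<union> M) x = card {y \<in> endpoints C. y \<le> x} + (\<Sum>i\<in>N. card (?E i))"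
    by (simp add: position_def)
  \<comment> \<open>An interval that does not contain \<open>x\<close> lies entirely before or
    entirely after \<open>x\<close>, so it contributes all of its endpoints, an even number, or
    none.\<close>
  have away: "even (card (?E i))" if "i \<in> N" "x \<notin> {s i..t i}" for i
  proof (cases "x < s i")
    case True
    then have "?E i = {}" by auto
    then show ?thesis by (simp only: card.empty) simp
  next
    case False
    then have "?E i = endpoints M \<inter> {s i..t i}" using that by auto
    then show ?thesis using ev[OF that(1)] by simp
  qed
  show "even (position (C \<union> M) x) \<longleftrightarrow> even (card {y \<in> endpoints C. y \<le> x})"
    if "x \<notin> (\<Union>i\<in>N. {s i..t i})"
  proof -
    have "even (\<Sum>i\<in>N. card (?E i))" using that by (intro dvd_sum away) auto
    then show ?thesis by (simp add: pos)
  qed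
  show "even (position (C \<union> M) x) \<longleftrightarrow> even (card {y \<in> endpoints C. y \<le> x} + card (?E k))"
    if "k \<in> N" "x \<in> {s k..t k}"
  proof -
    have "even (\<Sum>i\<in>N - {k}. card (?E i))" using that disjoint by (intro dvd_sum away) blast+
    then show ?thesis using assms(1) that by (simp add: pos sum.remove[of N k])
  qed
qed

text \<open>\<open>N\<close> indexes the arcs in the disc of a move, \<open>C\<close> consists of
  the untouched chords, and \<open>M\<close> and \<open>M'\<close> come from the crossings in the
  disc before and after. All three moves are instances; in the first two, one of \<open>M\<close>
  and \<open>M'\<close> is empty.\<close>

locale local_change =
  fixes C M M' :: "chord set" and N :: "nat set" and s t :: "nat \<Rightarrow> real"
  assumes finite_N: "finite N"
    and gauss: "gauss_like (C \<union> M)" and gauss': "gauss_like (C \<union> M')"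
    and disjoint: "\<And>i j. i \<in> N \<Longrightarrow> j \<in> N \<Longrightarrow> i \<noteq> j \<Longrightarrow> {s i..t i} \<inter> {s j..t j} = {}"
    and C_outside: "endpoints C \<inter> (\<Union>i\<in>N. {s i..t i}) = {}"
    and M_inside: "endpoints M \<subseteq> (\<Union>i\<in>N. {s i..t i})"
    and M'_inside: "endpoints M' \<subseteq> (\<Union>i\<in>N. {s i..t i})"
    and ev: "\<And>i. i \<in> N \<Longrightarrow> even (card (endpoints M \<inter> {s i..t i}))"
    and ev': "\<And>i. i \<in> N \<Longrightarrow> even (card (endpoints M' \<inter> {s i..t i}))"
begin

lemma flip: "local_change C M' M N s t"
  using finite_N gauss gauss' disjoint C_outside M_inside M'_inside ev ev'
  by (simp add: local_change_def)

lemma finite_C [simp]: "finite C" and finite_M [simp]: "finite M" and finite_M' [simp]: "finite M'"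
  using gauss gauss' by (auto simp: gauss_like_def)

lemma finite_endpoints_C [simp]: "finite (endpoints C)"
  and finite_endpoints_M [simp]: "finite (endpoints M)"
  by (auto simp: endpoints_def)

lemma endpoint_C_outside: "z \<in> endpoints C \<Longrightarrow> k \<in> N \<Longrightarrow> z \<notin> {s k..t k}"
  using C_outside by blast

lemma chord_C:
  assumes "(p, q) \<in> C"
  shows "p \<in> endpoints C" "q \<in> endpoints C" "p \<noteq> q"
proof -
  show "p \<in> endpoints C" "q \<in> endpoints C"
    using assms by (force simp: endpoints_def)+
  have "fst (p, q) \<noteq> snd (p, q)"
    using gauss assms unfolding gauss_like_def by blast
  then show "p \<noteq> q" by simp
qed

lemma C_M_disjoint: "C \<inter> M = {}"
  using C_outside M_inside unfolding endpoints_def by blast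

lemma odd_count_C_M: "odd_count (C \<union> M) P \<longleftrightarrow> (odd_count C P \<noteq> odd_count M P)"
  by (simp add: odd_count_Un C_M_disjoint)

lemmas even_position_outside = even_position_outside[OF finite_N finite_endpoints_C finite_endpoints_M
    disjoint C_outside M_inside ev]
lemmas even_position_inside = even_position_inside[OF finite_N finite_endpoints_C finite_endpoints_M
    disjoint C_outside M_inside ev]

text \<open>Parity of the number of endpoints of \<open>C\<close> that precede the interval. It
  mentions neither \<open>M\<close> nor \<open>M'\<close>, which makes it the common reference for
  positions before and after a move.\<close>

definition base :: "nat \<Rightarrow> bool" where
  "base k \<longleftrightarrow> even (card {y \<in> endpoints C. y \<le> s k})"

lemma base_eq:
  assumes "k \<in> N" "x \<in> {s k..t k}"
  shows "base k \<longleftrightarrow> even (card {y \<in> endpoints C. y \<le> x})"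
proof -
  have "y \<le> s k \<longleftrightarrow> y \<le> x" if "y \<in> endpoints C" for y
  proof -
    have "y \<notin> {s k..t k}" by (rule endpoint_C_outside[OF that assms(1)])
    then show ?thesis using assms(2) by auto
  qed
  then have "{y \<in> endpoints C. y \<le> s k} = {y \<in> endpoints C. y \<le> x}" by auto
  then show ?thesis by (simp add: base_def)
qed

text \<open>The earlier of the two endpoints counts only itself, the later one counts both; the
  other intervals contribute an even number.\<close>

lemma even_position_pair:
  assumes "k \<in> N" "endpoints M \<inter> {s k..t k} = {u, v}" "u \<noteq> v"
  shows "even (position (C \<union> M) u) \<longleftrightarrow> ((u < v) \<noteq> base k)"
proof -
  have u: "u \<in> {s k..t k}" using assms(2) by blast
  have "{y \<in> endpoints M \<inter> {s k..t k}. y \<le> u} = (if u < v then {u} else {u, v})"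
    using assms(2,3) by auto
  then have "even (card {y \<in> endpoints M \<inter> {s k..t k}. y \<le> u}) = (\<not> u < v)"
    using assms(3) by simp
  then show ?thesis
    using even_position_inside[OF _ _ _ _ assms(1) u] base_eq[OF assms(1) u] by auto
qed

text \<open>An endpoint that moves within its interval passes no endpoint of \<open>C\<close>, so
  every comparison in \<open>linked_xor\<close> keeps its value.\<close>

lemma linked_M_cong:
  assumes c: "c \<in> C" and "k \<in> N" "l \<in> N" and x: "x \<in> {s k..t k}" "x' \<in> {s k..t k}"
    and y: "y \<in> {s l..t l}" "y' \<in> {s l..t l}" and "x \<noteq> y" "x' \<noteq> y'"
  shows "linked c (x, y) \<longleftrightarrow> linked c (x', y')"
proof -
  obtain p q where c_eq: "c = (p, q)" by fastforce
  have pq: "p \<in> endpoints C" "q \<in> endpoints C" "p \<noteq> q"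
    using chord_C c by (simp_all add: c_eq)
  have out: "z \<notin> {s k..t k}" "z \<notin> {s l..t l}" if "z \<in> endpoints C" for z
    using endpoint_C_outside[OF that] assms(2,3) by blast+
  have same: "(z < x) = (z < x')" "(z < y) = (z < y')" if "z \<in> endpoints C" for z
    using out[OF that] x y by auto
  have "p \<noteq> z \<and> q \<noteq> z" if "z \<in> {s k..t k} \<union> {s l..t l}" for z
    using out[OF pq(1)] out[OF pq(2)] that by blast
  then have "distinct [p, q, x, y]" "distinct [p, q, x', y']"
    using pq(3) x y assms(8,9) by simp_all
  then show ?thesis
    unfolding c_eq by (simp only: linked_xor same[OF pq(1)] same[OF pq(2)])
qed

lemma not_linked_one_interval:
  assumes c: "c \<in> C" and "k \<in> N" and x: "x \<in> {s k..t k}" "y \<in> {s k..t k}" "x \<noteq> y"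
  shows "\<not> linked c (x, y)"
proof -
  obtain p q where c_eq: "c = (p, q)" by fastforce
  have pq: "p \<in> endpoints C" "q \<in> endpoints C" "p \<noteq> q"
    using chord_C c by (simp_all add: c_eq)
  have out: "z \<notin> {s k..t k}" if "z \<in> endpoints C" for z
    by (rule endpoint_C_outside[OF that assms(2)])
  have "(z < x) = (z < y)" if "z \<in> endpoints C" for z
    using out[OF that] x by auto
  moreover have "p \<noteq> z \<and> q \<noteq> z" if "z \<in> {s k..t k}" for z
    using out[OF pq(1)] out[OF pq(2)] that by blast
  then have "distinct [p, q, x, y]"
    using pq(3) x by simp
  ultimately show ?thesis
    unfolding c_eq using pq by (simp add: linked_xor del: linked.simps)
qed

lemma even_chord_C:
  assumes "c \<in> C" "odd_count M (linked c) = odd_count M' (linked c)"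
  shows "even_chord (C \<union> M) c = even_chord (C \<union> M') c"
  using assms odd_count_C_M local_change.odd_count_C_M[OF flip]
  by (simp add: even_chord_odd_count)

text \<open>The first condition preserves the parities of the chords in \<open>C\<close>, and with
  these known the second preserves the types of the odd ones. Positions outside the intervals keep
  their parity, so the letters there are unchanged, and the third condition exchanges the product
  over each interval.\<close>

theorem gauss_phi_local_change:
  assumes linked: "\<And>c. c \<in> C \<Longrightarrow> odd_count M (linked c) = odd_count M' (linked c)"
    and even_linked: "\<And>c. c \<in> C \<Longrightarrow> odd_count M (\<lambda>d. even_chord (C \<union> M) d \<and> linked c d)
      = odd_count M' (\<lambda>d. even_chord (C \<union> M') d \<and> linked c d)"
    and inside: "\<And>k. k \<in> N \<Longrightarrow>
      ordered_prod (endpoint_letter (C \<union> M)) (endpoints M \<inter> {s k..t k})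
      = ordered_prod (endpoint_letter (C \<union> M')) (endpoints M' \<inter> {s k..t k})"
  shows "gauss_phi (C \<union> M) = gauss_phi (C \<union> M')"
proof -
  have ev: "even_chord (C \<union> M) c = even_chord (C \<union> M') c" if "c \<in> C" for c
    using even_chord_C linked that by blast
  have ty: "first_type (C \<union> M) c = first_type (C \<union> M') c"
    if "c \<in> C" "\<not> even_chord (C \<union> M') c" for c
  proof -
    have "odd_count C (\<lambda>d. even_chord (C \<union> M) d \<and> linked c d)
        = odd_count C (\<lambda>d. even_chord (C \<union> M') d \<and> linked c d)"
      by (rule odd_count_cong) (simp add: ev)
    then show ?thesis
      using that ev[OF that(1)] even_linked[OF that(1)]
      by (simp add: first_type_odd_count odd_count_C_M local_change.odd_count_C_M[OF flip])
  qed
  have "ordered_prod (endpoint_letter (C \<union> M)) (endpoints (C \<union> M))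
      = ordered_prod (endpoint_letter (C \<union> M')) (endpoints (C \<union> M'))"
  proof (rule ordered_prod_replace_intervals[OF finite_N])
    show "endpoint_letter (C \<union> M) x = endpoint_letter (C \<union> M') x"
      if "x \<in> endpoints (C \<union> M) - (\<Union>i\<in>N. {s i..t i})" for x
    proof -
      have pos: "even (position (C \<union> M) x) = even (position (C \<union> M') x)"
        using even_position_outside[of x] local_change.even_position_outside[OF flip, of x] that
        by simp
      from that M_inside have "x \<in> endpoints C" unfolding endpoints_Un by blast
      then obtain c where c: "c \<in> C" "x = fst c \<or> x = snd c" by (auto simp: endpoints_def)
      then have "c = mk_chord True (fst c) (snd c)" by (simp add: mk_chord_def)
      with c have "mk_chord True (fst c) (snd c) \<in> C" "x = fst c \<or> x = snd c" by simp_all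
      \<comment> \<open>The types are compared only for odd chords; the letter of an even chord is
        \<open>a\<close> whatever the flag.\<close>
      moreover have "letter (even_chord (C \<union> M) c) w (first_type (C \<union> M) c) p
          = letter (even_chord (C \<union> M') c) w (first_type (C \<union> M') c) p" for w p
        using ev[OF c(1)] ty[OF c(1)] by (cases "even_chord (C \<union> M') c") simp_all
      ultimately show ?thesis
        using endpoint_letter_chord[OF gauss, of True "fst c" "snd c"]
          endpoint_letter_chord[OF gauss', of True "fst c" "snd c"] pos
        by (auto simp: mk_chord_def)
    qed
    show "endpoints (C \<union> M) - (\<Union>i\<in>N. {s i..t i}) = endpoints (C \<union> M') - (\<Union>i\<in>N. {s i..t i})"
      using M_inside M'_inside unfolding endpoints_Un by blast
    show "ordered_prod (endpoint_letter (C \<union> M)) (endpoints (C \<union> M) \<inter> {s i..t i})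
        = ordered_prod (endpoint_letter (C \<union> M')) (endpoints (C \<union> M') \<inter> {s i..t i})"
      if "i \<in> N" for i
    proof -
      have "endpoints (C \<union> M) \<inter> {s i..t i} = endpoints M \<inter> {s i..t i}"
        "endpoints (C \<union> M') \<inter> {s i..t i} = endpoints M' \<inter> {s i..t i}"
        using C_outside that unfolding endpoints_Un by blast+
      then show ?thesis using inside[OF that] by simp
    qed
  qed (use gauss gauss' disjoint in \<open>simp_all add: finite_endpoints\<close>)
  then show ?thesis by (simp add: gauss_phi_ordered_prod)
qed

end

text \<open>In the form of \<open>linked_xor\<close> the comparisons with \<open>x\<close> occur
  twice and cancel. For the three chords of a third move this means that an outside chord is linked
  with an even number of them.\<close>

lemma linked_triangle:
  assumes "distinct [p, q, x, y, z]"
  shows "(linked (p, q) (x, y) \<noteq> linked (p, q) (x, z)) = linked (p, q) (y, z)"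
  using assms by (simp add: linked_xor) blast

lemma odd_count_False [simp]: "\<not> odd_count A (\<lambda>_. False)"
  by (simp add: odd_count_def)

lemma endpoints_empty [simp]: "endpoints {} = {}"
  by (simp add: endpoints_def)

lemma endpoints_insert_mk_chord [simp]:
  "endpoints (insert (mk_chord w x y) A) = insert x (insert y (endpoints A))"
  by (auto simp: endpoints_def mk_chord_def)

lemma mk_chord_eq_iff:
  "mk_chord w x y = mk_chord w' x' y' \<longleftrightarrow>
    (if w = w' then x = x' \<and> y = y' else x = y' \<and> y = x')"
  by (auto simp: mk_chord_def)

lemma less_disjoint_intervals:
  fixes a b c d :: real
  assumes "{a..b} \<inter> {c..d} = {}" "x \<in> {a..b}" "x' \<in> {a..b}" "y \<in> {c..d}" "y' \<in> {c..d}"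
  shows "(x < y) = (x' < y')"
proof -
  have "b < c \<or> d < a"
  proof (rule ccontr)
    assume "\<not> ?thesis"
    then have "max a c \<in> {a..b} \<inter> {c..d}" using assms(2-) by auto
    then show False using assms(1) by blast
  qed
  then show ?thesis using assms(2-) by auto
qed

lemma disjoint_imp_noteq: "A \<inter> B = {} \<Longrightarrow> x \<in> A \<Longrightarrow> y \<in> B \<Longrightarrow> x \<noteq> y"
  by blast

context local_change
begin

text \<open>Of the four comparisons in \<open>linked_xor\<close> only that of \<open>x\<close> with
  \<open>y\<close> is between points of the same interval. The other three are decided by the order
  of the intervals, so reversing \<open>x\<close> and \<open>y\<close> switches the linking.\<close>

lemma linked_swap:
  assumes "i \<in> N" "j \<in> N" "k \<in> N" "distinct [i, j, k]"
    and x: "x \<in> {s i..t i}" "y \<in> {s i..t i}" "x' \<in> {s i..t i}" "y' \<in> {s i..t i}"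
    and u: "u \<in> {s j..t j}" "u' \<in> {s j..t j}" and v: "v \<in> {s k..t k}" "v' \<in> {s k..t k}"
    and swap: "x \<noteq> y" "x' \<noteq> y'" "(x < y) = (y' < x')"
  shows "linked (x, u) (y, v) \<longleftrightarrow> \<not> linked (x', u') (y', v')"
proof -
  have dis: "{s i..t i} \<inter> {s j..t j} = {}" "{s i..t i} \<inter> {s k..t k} = {}"
    "{s j..t j} \<inter> {s k..t k} = {}" "{s j..t j} \<inter> {s i..t i} = {}"
    by (intro disjoint; use assms(1-4) in simp)+
  have less: "(x < v) = (x' < v')" "(u < y) = (u' < y')" "(u < v) = (u' < v')"
    using less_disjoint_intervals[OF dis(2) x(1,3) v] less_disjoint_intervals[OF dis(4) u x(2,4)]
      less_disjoint_intervals[OF dis(3) u v] by blast+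
  have "distinct [z, a, z', b]"
    if "z \<in> {s i..t i}" "z' \<in> {s i..t i}" "z \<noteq> z'" "a \<in> {s j..t j}" "b \<in> {s k..t k}" for z z' a b
    using that disjoint_imp_noteq[OF dis(1) that(1,4)] disjoint_imp_noteq[OF dis(1) that(2,4)]
      disjoint_imp_noteq[OF dis(2) that(1,5)] disjoint_imp_noteq[OF dis(2) that(2,5)]
      disjoint_imp_noteq[OF dis(3) that(4,5)] by auto
  then have "distinct [x, u, y, v]" "distinct [x', u', y', v']"
    using x u v swap(1,2) by blast+
  moreover have "(x' < y') = (\<not> x < y)" using swap by auto
  ultimately show ?thesis by (simp add: linked_xor less) blast
qed

text \<open>For chords of \<open>C\<close> the position inside an interval is irrelevant, so three
  chords between three intervals behave like the sides of a triangle with one vertex in each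
  interval.\<close>

lemma linked_C_triangle:
  assumes c: "c \<in> C" and N: "i \<in> N" "j \<in> N" "k \<in> N" "distinct [i, j, k]"
    and x: "x \<in> {s i..t i}" "x' \<in> {s i..t i}" and y: "y \<in> {s j..t j}" "y' \<in> {s j..t j}"
    and z: "z \<in> {s k..t k}" "z' \<in> {s k..t k}"
  shows "(linked c (x, y) \<noteq> linked c (x', z)) = linked c (y', z')"
proof -
  have dis: "{s i..t i} \<inter> {s j..t j} = {}" "{s i..t i} \<inter> {s k..t k} = {}"
    "{s j..t j} \<inter> {s k..t k} = {}"
    by (intro disjoint; use N in simp)+
  then have ne: "x \<noteq> y" "x \<noteq> z" "x' \<noteq> z" "y \<noteq> z" "y' \<noteq> z'"
    using x y z disjoint_imp_noteq[OF dis(1)] disjoint_imp_noteq[OF dis(2)]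
      disjoint_imp_noteq[OF dis(3)] by blast+
  obtain p q where c_eq: "c = (p, q)" by fastforce
  have linked: "linked c (x', z) = linked c (x, z)" "linked c (y', z') = linked c (y, z)"
    using linked_M_cong[OF c] N x y z ne by blast+
  have "p \<noteq> r \<and> q \<noteq> r" if "r \<in> {s i..t i} \<union> {s j..t j} \<union> {s k..t k}" for r
    using that chord_C(1,2)[OF c[unfolded c_eq]] endpoint_C_outside N by blast
  then have "distinct [p, q, x, y, z]"
    using chord_C(3)[OF c[unfolded c_eq]] x(1) y(1) z(1) ne by simp
  from linked_triangle[OF this] show ?thesis
    using linked by (simp add: c_eq)
qed

text \<open>The earlier endpoint is the first of \<open>M\<close> in its interval, hence the flag
  \<open>\<not> base k\<close>; the later one is the second, hence \<open>base k\<close>.\<close>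

lemma ordered_prod_two_endpoints:
  assumes "k \<in> N" "endpoints M \<inter> {s k..t k} = {u, v}" "u \<noteq> v"
    and "endpoint_letter (C \<union> M) u = letter e w g (even (position (C \<union> M) u))"
    and "endpoint_letter (C \<union> M) v = letter e' w' g' (even (position (C \<union> M) v))"
  shows "ordered_prod (endpoint_letter (C \<union> M)) (endpoints M \<inter> {s k..t k}) =
    (if u < v then letter e w g (\<not> base k) \<otimes>\<^bsub>G2\<^esub> letter e' w' g' (base k)
     else letter e' w' g' (\<not> base k) \<otimes>\<^bsub>G2\<^esub> letter e w g (base k))"
proof -
  have "even (position (C \<union> M) u) \<longleftrightarrow> ((u < v) \<noteq> base k)"
    "even (position (C \<union> M) v) \<longleftrightarrow> ((v < u) \<noteq> base k)"
    using even_position_pair[of k u v] even_position_pair[of k v u] assms(1-3)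
    by (simp_all add: insert_commute)
  then show ?thesis
    using assms(3) ordered_prod_pair[of u v "endpoint_letter (C \<union> M)"]
      ordered_prod_pair[of v u "endpoint_letter (C \<union> M)"]
    unfolding assms(2) by (cases "u < v") (auto simp: insert_commute[of v u] assms(4,5))
qed

end

section \<open>The three Reidemeister moves on Gauss diagrams\<close>

lemma gauss_phi_R1:
  fixes k :: nat
  assumes gauss: "gauss_like C" "gauss_like (C \<union> {mk_chord w x y})"
    and C: "endpoints C \<inter> {s k..t k} = {}" and x: "x \<in> {s k..t k}" "y \<in> {s k..t k}" "x \<noteq> y"
  shows "gauss_phi C = gauss_phi (C \<union> {mk_chord w x y})"
proof -
  let ?X = "mk_chord w x y"
  note Un_insert_right [simp del]
  have ends: "endpoints {?X} \<inter> {s k..t k} = {x, y}" using x by auto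
  interpret L: local_change C "{}" "{?X}" "{k}" s t
    using gauss C x ends by unfold_locales simp_all
  interpret L': local_change C "{?X}" "{}" "{k}" s t
    by (rule L.flip)
  have unlinked: "\<not> linked c (x, y)" if "c \<in> C" for c
    using L.not_linked_one_interval[of c k x y] that x by simp
  have "odd_count C (linked (x, y)) = odd_count C (\<lambda>_. False)"
    by (rule odd_count_cong) (simp add: unlinked linked_commute[of "(x, y)"])
  then have even: "even_chord (C \<union> {?X}) ?X"
    by (simp add: even_chord_odd_count L'.odd_count_C_M odd_count_insert)
  \<comment> \<open>The new chord is even, so all flags except its parity may be chosen
    arbitrarily.\<close>
  have "ordered_prod (endpoint_letter (C \<union> {?X})) {x, y} = \<one>\<^bsub>G2\<^esub>"
    using L'.ordered_prod_two_endpoints[of k x y True w True True "\<not> w" True, unfolded ends]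
      endpoint_letter_chord[OF gauss(2), of w x y] even x(3) by (simp add: G2_relations)
  then have "ordered_prod (endpoint_letter (C \<union> {?X})) (endpoints {?X} \<inter> {s k..t k}) = \<one>\<^bsub>G2\<^esub>"
    by (simp only: ends)
  then have "gauss_phi (C \<union> {}) = gauss_phi (C \<union> {?X})"
    using unlinked
    by (intro L.gauss_phi_local_change)
       (simp_all add: odd_count_insert del: endpoints_insert_mk_chord)
  then show ?thesis by simp
qed

text \<open>The common flag \<open>w\<close> expresses that the same arc is over at both vertices of
  the bigon. Either chord can be moved onto the other within the two intervals, so they are linked
  with the same chords of \<open>C\<close>, and their mutual linking is symmetric. This gives equal
  parities and types.\<close>

lemma gauss_phi_R2:
  fixes k l :: nat
  assumes gauss: "gauss_like C" "gauss_like (C \<union> {mk_chord w x0 x1, mk_chord w y0 y1})"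
    and dis: "k \<noteq> l" "{s k..t k} \<inter> {s l..t l} = {}"
    and C: "endpoints C \<inter> ({s k..t k} \<union> {s l..t l}) = {}"
    and x: "x0 \<in> {s k..t k}" "y0 \<in> {s k..t k}" "x0 \<noteq> y0"
      "x1 \<in> {s l..t l}" "y1 \<in> {s l..t l}" "x1 \<noteq> y1"
  shows "gauss_phi C = gauss_phi (C \<union> {mk_chord w x0 x1, mk_chord w y0 y1})"
proof -
  let ?X = "mk_chord w x0 x1" and ?Y = "mk_chord w y0 y1"
  note Un_insert_right [simp del]
  have ne: "x0 \<noteq> x1" "y0 \<noteq> y1" "x0 \<noteq> y1" "y0 \<noteq> x1"
    using x disjoint_imp_noteq[OF dis(2)] by blast+
  have "z \<notin> {s l..t l}" if "z \<in> {s k..t k}" for z using dis(2) that by blast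
  moreover have "z \<notin> {s k..t k}" if "z \<in> {s l..t l}" for z using dis(2) that by blast
  ultimately have ends: "endpoints {?X, ?Y} \<inter> {s k..t k} = {x0, y0}"
    "endpoints {?X, ?Y} \<inter> {s l..t l} = {x1, y1}"
    using x by auto
  interpret L: local_change C "{}" "{?X, ?Y}" "{k, l}" s t
  proof
    show "{s i..t i} \<inter> {s j..t j} = {}" if "i \<in> {k, l}" "j \<in> {k, l}" "i \<noteq> j" for i j
      using that dis(2) by blast
    show "endpoints {?X, ?Y} \<subseteq> (\<Union>i\<in>{k, l}. {s i..t i})"
      using x by simp
    show "even (card (endpoints {?X, ?Y} \<inter> {s i..t i}))" if "i \<in> {k, l}" for i
      using that ends x by auto
  qed (use gauss C in simp_all)
  interpret L': local_change C "{?X, ?Y}" "{}" "{k, l}" s t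
    by (rule L.flip)
  have [simp]: "?X \<noteq> ?Y" using x(3) ne by (simp add: mk_chord_eq_iff)
  let ?G = "C \<union> {?X, ?Y}"
  have linked: "linked c (y0, y1) = linked c (x0, x1)" if "c \<in> C" for c
    using L.linked_M_cong[of c k l y0 x0 y1 x1] that x ne by simp
  have "odd_count C (linked (y0, y1)) = odd_count C (linked (x0, x1))"
    by (rule odd_count_cong) (simp add: linked linked_commute[of "(_, _)"])
  then have even: "even_chord ?G ?Y = even_chord ?G ?X"
    by (simp add: even_chord_odd_count L'.odd_count_C_M odd_count_insert
        linked_commute[of "(y0, y1)" "(x0, x1)"])
  have "odd_count C (\<lambda>d. even_chord ?G d \<and> linked (y0, y1) d)
      = odd_count C (\<lambda>d. even_chord ?G d \<and> linked (x0, x1) d)"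
    by (rule odd_count_cong) (simp add: linked linked_commute[of "(_, _)"])
  then have type: "first_type ?G ?Y = first_type ?G ?X" if "\<not> even_chord ?G ?X"
    using that even
    by (simp add: first_type_odd_count L'.odd_count_C_M odd_count_insert
        linked_commute[of "(y0, y1)" "(x0, x1)"])
  have letters: "letter (even_chord ?G ?Y) v (first_type ?G ?Y) p
      = letter (even_chord ?G ?X) v (first_type ?G ?X) p" for v p
    using even type by (cases "even_chord ?G ?X") simp_all
  have adjacent: "letter e v f (\<not> p) \<otimes>\<^bsub>G2\<^esub> letter e v f p = \<one>\<^bsub>G2\<^esub>" for e v f p
    using letter_adjacent[of e v f "\<not> p"] by simp
  note X = endpoint_letter_chord[OF gauss(2), of w x0 x1, simplified]
  note Y = endpoint_letter_chord[OF gauss(2), of w y0 y1, simplified, unfolded letters]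
  have "ordered_prod (endpoint_letter ?G) {x0, y0} = \<one>\<^bsub>G2\<^esub>"
    using L'.ordered_prod_two_endpoints[OF _ ends(1) x(3) X(1) Y(1), unfolded ends]
    by (simp add: adjacent)
  moreover have "ordered_prod (endpoint_letter ?G) {x1, y1} = \<one>\<^bsub>G2\<^esub>"
    using L'.ordered_prod_two_endpoints[OF _ ends(2) x(6) X(2) Y(2), unfolded ends]
    by (simp add: adjacent)
  ultimately have "ordered_prod (endpoint_letter (C \<union> {})) (endpoints {} \<inter> {s i..t i})
      = ordered_prod (endpoint_letter ?G) (endpoints {?X, ?Y} \<inter> {s i..t i})" if "i \<in> {k, l}" for i
    using that
    by (elim insertE emptyE) (simp_all only: ends endpoints_empty Int_empty_left ordered_prod_empty)
  \<comment> \<open>A chord of \<open>C\<close> is linked with both new chords or with neither, and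
    these have the same parity, so both counts for it are even.\<close>
  then have "gauss_phi (C \<union> {}) = gauss_phi ?G"
    by (intro L.gauss_phi_local_change) (simp_all add: odd_count_insert linked even)
  then show ?thesis by simp
qed

lemma triangle_chords:
  assumes dis: "K \<inter> L = {}" "K \<inter> J = {}" "L \<inter> J = {}"
    and x: "x0 \<in> K" "y0 \<in> K" "x1 \<in> L" "z1 \<in> L" "y2 \<in> J" "z2 \<in> J"
    and ne: "x0 \<noteq> y0" "x1 \<noteq> z1" "y2 \<noteq> z2"
  shows "endpoints {mk_chord w0 x0 x1, mk_chord w1 y0 y2, mk_chord w2 z1 z2} \<inter> K = {x0, y0}"
    and "endpoints {mk_chord w0 x0 x1, mk_chord w1 y0 y2, mk_chord w2 z1 z2} \<inter> L = {x1, z1}"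
    and "endpoints {mk_chord w0 x0 x1, mk_chord w1 y0 y2, mk_chord w2 z1 z2} \<inter> J = {y2, z2}"
    and "odd_count {mk_chord w0 x0 x1, mk_chord w1 y0 y2, mk_chord w2 z1 z2} P \<longleftrightarrow>
      (P (mk_chord w0 x0 x1) \<noteq> (P (mk_chord w1 y0 y2) \<noteq> P (mk_chord w2 z1 z2)))"
proof -
  have out: "z \<notin> L" "z \<notin> J" if "z \<in> K" for z using dis that by blast+
  have out': "z \<notin> K" "z \<notin> J" if "z \<in> L" for z using dis that by blast+
  have out'': "z \<notin> K" "z \<notin> L" if "z \<in> J" for z using dis that by blast+
  show "endpoints {mk_chord w0 x0 x1, mk_chord w1 y0 y2, mk_chord w2 z1 z2} \<inter> K = {x0, y0}"
    "endpoints {mk_chord w0 x0 x1, mk_chord w1 y0 y2, mk_chord w2 z1 z2} \<inter> L = {x1, z1}"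
    "endpoints {mk_chord w0 x0 x1, mk_chord w1 y0 y2, mk_chord w2 z1 z2} \<inter> J = {y2, z2}"
    by (simp_all add: Int_insert_left x out[OF x(1)] out[OF x(2)] out'[OF x(3)] out'[OF x(4)]
        out''[OF x(5)] out''[OF x(6)])
  have "x0 \<noteq> y2" "x0 \<noteq> z1" "x0 \<noteq> z2" "y0 \<noteq> z1" "y0 \<noteq> z2"
    using x out by blast+
  then show "odd_count {mk_chord w0 x0 x1, mk_chord w1 y0 y2, mk_chord w2 z1 z2} P \<longleftrightarrow>
      (P (mk_chord w0 x0 x1) \<noteq> (P (mk_chord w1 y0 y2) \<noteq> P (mk_chord w2 z1 z2)))"
    using ne by (simp add: odd_count_insert mk_chord_eq_iff)
qed

text \<open>\<open>X\<close>, \<open>Y\<close> and \<open>Z\<close> join the intervals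
  \<open>k\<close> and \<open>l\<close>, \<open>k\<close> and \<open>m\<close>, \<open>l\<close> and
  \<open>m\<close>. The geometry of the move enters through \<open>swap\<close>: on each arc the two
  endpoints exchange their order.\<close>

lemma gauss_phi_R3:
  fixes C :: "chord set" and s t :: "nat \<Rightarrow> real" and k l m :: nat
    and x0 x1 y0 y2 z1 z2 x0' x1' y0' y2' z1' z2' :: real
    and w0 w1 w2 :: bool
  defines "X \<equiv> mk_chord w0 x0 x1" and "Y \<equiv> mk_chord w1 y0 y2" and "Z \<equiv> mk_chord w2 z1 z2"
    and "X' \<equiv> mk_chord w0 x0' x1'" and "Y' \<equiv> mk_chord w1 y0' y2'" and "Z' \<equiv> mk_chord w2 z1' z2'"
  assumes gauss: "gauss_like (C \<union> {X, Y, Z})" and gauss': "gauss_like (C \<union> {X', Y', Z'})"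
    and klm: "distinct [k, l, m]"
    and dis: "{s k..t k} \<inter> {s l..t l} = {}" "{s k..t k} \<inter> {s m..t m} = {}"
      "{s l..t l} \<inter> {s m..t m} = {}"
    and C: "endpoints C \<inter> ({s k..t k} \<union> {s l..t l} \<union> {s m..t m}) = {}"
    and K: "x0 \<in> {s k..t k}" "y0 \<in> {s k..t k}" "x0' \<in> {s k..t k}" "y0' \<in> {s k..t k}"
    and L: "x1 \<in> {s l..t l}" "z1 \<in> {s l..t l}" "x1' \<in> {s l..t l}" "z1' \<in> {s l..t l}"
    and J: "y2 \<in> {s m..t m}" "z2 \<in> {s m..t m}" "y2' \<in> {s m..t m}" "z2' \<in> {s m..t m}"
    and ne: "x0 \<noteq> y0" "x1 \<noteq> z1" "y2 \<noteq> z2"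
    and ne': "x0' \<noteq> y0'" "x1' \<noteq> z1'" "y2' \<noteq> z2'"
    and swap: "(x0 < y0) = (y0' < x0')" "(x1 < z1) = (z1' < x1')" "(y2 < z2) = (z2' < y2')"
  shows "gauss_phi (C \<union> {X, Y, Z}) = gauss_phi (C \<union> {X', Y', Z'})"
proof -
  note Un_insert_right [simp del]
  note tri = triangle_chords[OF dis K(1,2) L(1,2) J(1,2) ne, of w0 w1 w2, folded X_def Y_def Z_def]
  note tri' = triangle_chords[OF dis K(3,4) L(3,4) J(3,4) ne', of w0 w1 w2, folded X'_def Y'_def Z'_def]
  interpret L: local_change C "{X, Y, Z}" "{X', Y', Z'}" "{k, l, m}" s t
  proof
    show "{s i..t i} \<inter> {s j..t j} = {}" if "i \<in> {k, l, m}" "j \<in> {k, l, m}" "i \<noteq> j" for i j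
      using that dis by blast
    show "endpoints {X, Y, Z} \<subseteq> (\<Union>i\<in>{k, l, m}. {s i..t i})"
      using K L J by (simp add: X_def Y_def Z_def)
    show "endpoints {X', Y', Z'} \<subseteq> (\<Union>i\<in>{k, l, m}. {s i..t i})"
      using K L J by (simp add: X'_def Y'_def Z'_def)
    show "even (card (endpoints {X, Y, Z} \<inter> {s i..t i}))" if "i \<in> {k, l, m}" for i
      using that tri(1-3) ne by auto
    show "even (card (endpoints {X', Y', Z'} \<inter> {s i..t i}))" if "i \<in> {k, l, m}" for i
      using that tri'(1-3) ne' by auto
    show "endpoints C \<inter> (\<Union>i\<in>{k, l, m}. {s i..t i}) = {}"
      using C by (simp add: Un_assoc)
  qed (use gauss gauss' in simp_all)
  interpret L': local_change C "{X', Y', Z'}" "{X, Y, Z}" "{k, l, m}" s t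
    by (rule L.flip)
  let ?G = "C \<union> {X, Y, Z}" and ?G' = "C \<union> {X', Y', Z'}"
  have noteq: "x0 \<noteq> x1" "x0' \<noteq> x1'" "y0 \<noteq> y2" "y0' \<noteq> y2'" "z1 \<noteq> z2" "z1' \<noteq> z2'"
    using K L J disjoint_imp_noteq[OF dis(1)] disjoint_imp_noteq[OF dis(2)]
      disjoint_imp_noteq[OF dis(3)] by blast+
  have linked_C: "linked c X' = linked c X" "linked c Y' = linked c Y" "linked c Z' = linked c Z"
    "(linked c X \<noteq> linked c Y) = linked c Z" if "c \<in> C" for c
    using L.linked_M_cong[OF that _ _ K(3,1) L(3,1) noteq(2,1)]
      L.linked_M_cong[OF that _ _ K(4,2) J(3,1) noteq(4,3)]
      L.linked_M_cong[OF that _ _ L(4,2) J(4,2) noteq(6,5)]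
      L.linked_C_triangle[OF that _ _ _ _ K(1,2) L(1,2) J(1,2)] klm
    by (simp_all add: X_def Y_def Z_def X'_def Y'_def Z'_def)
  have count_C: "odd_count C (linked X') = odd_count C (linked X)"
    "odd_count C (linked Y') = odd_count C (linked Y)"
    "odd_count C (linked Z') = odd_count C (linked Z)"
    by (rule odd_count_cong, simp add: linked_C linked_commute[of X] linked_commute[of X']
      linked_commute[of Y] linked_commute[of Y'] linked_commute[of Z] linked_commute[of Z'])+
  have "odd_count C (linked Z) = odd_count C (\<lambda>c. linked X c \<noteq> linked Y c)"
    by (rule odd_count_cong) (use linked_C(4) in \<open>auto simp: linked_commute[of X]
      linked_commute[of Y] linked_commute[of Z]\<close>)
  then have count_Z: "odd_count C (linked Z) = (odd_count C (linked X) \<noteq> odd_count C (linked Y))"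
    by (simp only: odd_count_xor[OF L.finite_C])
  \<comment> \<open>Any two of the chords share exactly one arc: \<open>X\<close> and
    \<open>Y\<close> share \<open>k\<close>, \<open>X\<close> and \<open>Z\<close> share
    \<open>l\<close>, \<open>Y\<close> and \<open>Z\<close> share \<open>m\<close>. The order of
    their endpoints on that arc is reversed.\<close>
  have swapped: "linked X' Y' = (\<not> linked X Y)" "linked X' Z' = (\<not> linked X Z)"
    "linked Y' Z' = (\<not> linked Y Z)"
    using L.linked_swap[of k l m, OF _ _ _ _ K L(1,3) J(1,3) ne(1) ne'(1) swap(1)]
      L.linked_swap[of l k m, OF _ _ _ _ L K(1,3) J(2,4) ne(2) ne'(2) swap(2)]
      L.linked_swap[of m k l, OF _ _ _ _ J K(2,4) L(2,4) ne(3) ne'(3) swap(3)] klm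
    by (auto simp add: X_def Y_def Z_def X'_def Y'_def Z'_def linked_swap_ends[of x1 x0]
      linked_swap_ends[of x1' x0'] linked_swap_ends[of y2 y0] linked_swap_ends[of y2' y0']
      linked_commute[of _ "(z2, z1)"] linked_commute[of _ "(z2', z1')"]
      linked_swap_ends[of z2 z1] linked_swap_ends[of z2' z1'] linked_commute[of "(z1, z2)"]
      linked_commute[of "(z1', z2')"])
  note commute = linked_commute[of Y X] linked_commute[of Z X] linked_commute[of Z Y]
    linked_commute[of Y' X'] linked_commute[of Z' X'] linked_commute[of Z' Y']
  \<comment> \<open>Each of the three has its linking with both others switched, and the two changes
    cancel.\<close>
  have even: "even_chord ?G' X' = even_chord ?G X" "even_chord ?G' Y' = even_chord ?G Y"
    "even_chord ?G' Z' = even_chord ?G Z"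
    by (auto simp: even_chord_odd_count L.odd_count_C_M L'.odd_count_C_M tri(4) tri'(4)
      count_C swapped commute)
  \<comment> \<open>In the sum of the three parities each mutual linking is counted twice and the
    contributions of \<open>C\<close> cancel by \<open>count_Z\<close>, so an even number of the
    three chords is odd.\<close>
  have even_Z: "even_chord ?G Z = (even_chord ?G X = even_chord ?G Y)"
    by (auto simp: even_chord_odd_count L.odd_count_C_M tri(4) count_Z commute)
  have even_C: "even_chord ?G' c = even_chord ?G c" if "c \<in> C" for c
    using that by (intro L'.even_chord_C) (simp_all add: tri(4) tri'(4) linked_C)
  have count_even: "odd_count C (\<lambda>d. even_chord ?G' d \<and> linked X' d) = odd_count C (\<lambda>d. even_chord ?G d \<and> linked X d)"
    "odd_count C (\<lambda>d. even_chord ?G' d \<and> linked Y' d) = odd_count C (\<lambda>d. even_chord ?G d \<and> linked Y d)"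
    "odd_count C (\<lambda>d. even_chord ?G' d \<and> linked Z' d) = odd_count C (\<lambda>d. even_chord ?G d \<and> linked Z d)"
    by (rule odd_count_cong, simp add: even_C linked_C linked_commute[of X] linked_commute[of X']
      linked_commute[of Y] linked_commute[of Y'] linked_commute[of Z] linked_commute[of Z'])+
  \<comment> \<open>If one of the chords is odd, then exactly two are. Exactly one of the other two
    is therefore even, and among the linkings with even chords only that one is switched.\<close>
  have type: "\<not> even_chord ?G X \<Longrightarrow> first_type ?G' X' = (\<not> first_type ?G X)"
    "\<not> even_chord ?G Y \<Longrightarrow> first_type ?G' Y' = (\<not> first_type ?G Y)"
    "\<not> even_chord ?G Z \<Longrightarrow> first_type ?G' Z' = (\<not> first_type ?G Z)"
    using even_Z
    by (auto simp: first_type_odd_count even L.odd_count_C_M L'.odd_count_C_M tri(4) tri'(4)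
      count_even swapped commute)
  note X = endpoint_letter_chord[OF gauss, of w0 x0 x1, folded X_def, simplified]
    and Y = endpoint_letter_chord[OF gauss, of w1 y0 y2, folded Y_def, simplified]
    and Z = endpoint_letter_chord[OF gauss, of w2 z1 z2, folded Z_def, simplified]
    and X' = endpoint_letter_chord[OF gauss', of w0 x0' x1', folded X'_def, simplified, unfolded even]
    and Y' = endpoint_letter_chord[OF gauss', of w1 y0' y2', folded Y'_def, simplified, unfolded even]
    and Z' = endpoint_letter_chord[OF gauss', of w2 z1' z2', folded Z'_def, simplified, unfolded even]
  have inside: "ordered_prod (endpoint_letter ?G) (endpoints {X, Y, Z} \<inter> {s i..t i})
      = ordered_prod (endpoint_letter ?G') (endpoints {X', Y', Z'} \<inter> {s i..t i})"
    if "i \<in> {k, l, m}" "endpoints {X, Y, Z} \<inter> {s i..t i} = {u, v}" "u \<noteq> v"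
      "endpoints {X', Y', Z'} \<inter> {s i..t i} = {u', v'}" "u' \<noteq> v'" "(u < v) = (v' < u')"
      "endpoint_letter ?G u = letter e w f (even (position ?G u))"
      "endpoint_letter ?G v = letter e' w' f' (even (position ?G v))"
      "endpoint_letter ?G' u' = letter e w g (even (position ?G' u'))"
      "endpoint_letter ?G' v' = letter e' w' g' (even (position ?G' v'))"
      "\<not> e \<Longrightarrow> g = (\<not> f)" "\<not> e' \<Longrightarrow> g' = (\<not> f')" for i u v u' v' e w f g e' w' f' g'
  proof -
    \<comment> \<open>Either endpoint may come first along the line, so \<open>letter_swap\<close>
      is needed with both assignments of the roles.\<close>
    have "(u' < v') = (\<not> u < v)" using that(5,6) by auto
    then show ?thesis
      using L.ordered_prod_two_endpoints[OF that(1,2,3,7,8)]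
        L'.ordered_prod_two_endpoints[OF that(1,4,5,9,10)]
        letter_swap[of e g f e' g' f' w "\<not> L.base i" w', OF that(11,12)]
        letter_swap[of e' g' f' e g f w' "\<not> L.base i" w, OF that(12,11)]
      by auto
  qed
  show ?thesis
  proof (rule L.gauss_phi_local_change)
    show "ordered_prod (endpoint_letter ?G) (endpoints {X, Y, Z} \<inter> {s i..t i})
      = ordered_prod (endpoint_letter ?G') (endpoints {X', Y', Z'} \<inter> {s i..t i})"
      if "i \<in> {k, l, m}" for i
    proof -
      consider "i = k" | "i = l" | "i = m" using \<open>i \<in> {k, l, m}\<close> by blast
      then show ?thesis
      proof cases
        case 1
        show ?thesis
          unfolding 1 by (rule inside[OF _ tri(1) ne(1) tri'(1) ne'(1) swap(1) X(1) Y(1) X'(1) Y'(1)])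
            (use type in simp_all)
      next
        case 2
        show ?thesis
          unfolding 2 by (rule inside[OF _ tri(2) ne(2) tri'(2) ne'(2) swap(2) X(2) Z(1) X'(2) Z'(1)])
            (use type in simp_all)
      next
        case 3
        show ?thesis
          unfolding 3 by (rule inside[OF _ tri(3) ne(3) tri'(3) ne'(3) swap(3) Y(2) Z(2) Y'(2) Z'(2)])
            (use type in simp_all)
      qed
    qed
  qed (simp_all add: tri(4) tri'(4) linked_C even)
qed

text \<open>Linking, parity, type and position depend on the order of the endpoints alone. This
  accounts for reparametrisations of the line.\<close>

lemma gauss_phi_image:
  assumes r: "strict_mono r" and gauss: "gauss_like G"
  shows "gauss_phi (map_prod r r ` G) = gauss_phi G"
proof -
  let ?f = "map_prod r r"
  have inj: "inj r" by (rule strict_mono_imp_inj_on[OF r])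
  then have inj_f: "inj ?f" by (rule prod.inj_map[OF inj])
  have f_mk: "?f (mk_chord w x y) = mk_chord w (r x) (r y)" for w x y
    by (simp add: mk_chord_def)
  have "min (r x) (r y) = r (min x y)" "max (r x) (r y) = r (max x y)" for x y
    by (simp_all add: min_of_mono max_of_mono strict_mono_mono r)
  then have linked: "linked (?f c) (?f d) = linked c d" for c d
    by (cases c; cases d) (simp add: linked.simps strict_mono_less[OF r])
  have card_eq: "card {d \<in> ?f ` G. P d} = card {d \<in> G. P (?f d)}" for P
  proof -
    have "{d \<in> ?f ` G. P d} = ?f ` {d \<in> G. P (?f d)}" by auto
    then show ?thesis by (simp add: card_image inj_on_subset[OF inj_f])
  qed
  have even: "even_chord (?f ` G) (?f c) = even_chord G c" for c
    by (simp add: even_chord_def card_eq linked)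
  have type: "first_type (?f ` G) (?f c) = first_type G c" for c
    by (simp add: first_type_def odd_chord_def card_eq linked even)
  have ends: "endpoints (?f ` G) = r ` endpoints G"
    by (auto simp: endpoints_def image_iff) force+
  have pos: "position (?f ` G) (r x) = position G x" for x
  proof -
    have "{y \<in> endpoints (?f ` G). y \<le> r x} = r ` {y \<in> endpoints G. y \<le> x}"
      using r by (auto simp: ends strict_mono_less_eq)
    then show ?thesis by (simp add: position_def card_image inj_on_subset[OF inj])
  qed
  have gauss_f: "gauss_like (?f ` G)"
    using gauss inj unfolding gauss_like_def by (auto simp: inj_eq)
  have letter: "endpoint_letter (?f ` G) (r x) = endpoint_letter G x" if "x \<in> endpoints G" for x
  proof -
    obtain c where "c \<in> G" "x = fst c \<or> x = snd c"
      using \<open>x \<in> endpoints G\<close> by (auto simp: endpoints_def)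
    then have "mk_chord True x (snd c) \<in> G \<or> mk_chord False x (fst c) \<in> G"
      by (auto simp: mk_chord_def)
    then obtain w y where "mk_chord w x y \<in> G" by blast
    moreover from this have "mk_chord w (r x) (r y) \<in> ?f ` G"
      using f_mk by (metis imageI)
    ultimately show ?thesis
      using endpoint_letter_chord(1)[OF gauss] endpoint_letter_chord(1)[OF gauss_f]
        even[of "mk_chord w x y"] type[of "mk_chord w x y"] pos[of x] by (simp add: f_mk)
  qed
  have "gauss_phi (?f ` G) = ordered_prod (endpoint_letter (?f ` G) \<circ> r) (endpoints G)"
    using r gauss unfolding gauss_phi_ordered_prod ends
    by (intro ordered_prod_image) (simp_all add: finite_endpoints strict_mono_on_def strict_mono_def)
  also have "\<dots> = gauss_phi G"
    unfolding gauss_phi_ordered_prod by (rule ordered_prod_cong) (simp_all add: letter)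
  finally show ?thesis .
qed

section \<open>From diagrams to Gauss diagrams\<close>

lemma long_knot_over:
  assumes "long_knot_diagram pt K" "x \<noteq> y" "curve K x = curve K y"
  shows "x \<in> over K \<longleftrightarrow> y \<notin> over K"
  using assms by (simp add: long_knot_diagram_def)

lemma gauss_like_gauss_diagram:
  assumes K: "long_knot_diagram pt K"
  shows "gauss_like (gauss_diagram K)"
proof -
  have gen: "generic_immersion (curve K)" using K by (simp add: long_knot_diagram_def)
  then have triple: "x = y \<or> y = z \<or> x = z" if "curve K x = curve K y" "curve K y = curve K z" for x y z
    using that unfolding generic_immersion_def by blast
  have "gauss_diagram K \<subseteq> crossing_params (curve K) \<times> crossing_params (curve K)"
    unfolding gauss_diagram_def crossing_params_def by (auto, metis+)
  then have "finite (gauss_diagram K)"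
    using gen finite_subset by (auto simp: generic_immersion_def)
  moreover have dis: "{x, y} \<inter> {x', y'} = {}"
    if "(x, y) \<in> gauss_diagram K" "(x', y') \<in> gauss_diagram K" "(x, y) \<noteq> (x', y')" for x y x' y'
  proof -
    have xy: "x \<noteq> y" "curve K x = curve K y" "x \<in> over K" "y \<notin> over K"
      and xy': "x' \<noteq> y'" "curve K x' = curve K y'" "x' \<in> over K" "y' \<notin> over K"
      using that long_knot_over[OF K] by (auto simp: gauss_diagram_def)
    \<comment> \<open>No parameter is both over and under. A shared over-endpoint or a shared
      under-endpoint would produce a triple point.\<close>
    have "x \<noteq> y'" "y \<noteq> x'" using xy xy' by auto
    moreover have "x \<noteq> x'" using triple[of y x y'] xy xy' that(3) by auto
    moreover have "y \<noteq> y'" using triple[of x y x'] xy xy' that(3) by auto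
    ultimately show ?thesis by simp
  qed
  ultimately show ?thesis
    unfolding gauss_like_def
  proof (intro conjI ballI impI)
    show "fst c \<noteq> snd c" if "c \<in> gauss_diagram K" for c
      using that by (auto simp: gauss_diagram_def)
    show "{fst c, snd c} \<inter> {fst d, snd d} = {}"
      if "c \<in> gauss_diagram K" "d \<in> gauss_diagram K" "c \<noteq> d" for c d
      using that by (intro dis) simp_all
  qed
qed

lemma phi2_planar_isotopic:
  assumes "long_knot_diagram pt K" "long_knot_diagram pt K'" "planar_isotopic K K'"
  shows "phi2 K = phi2 K'"
  using assms(3) unfolding planar_isotopic_def
proof (elim exE conjE)
  fix H :: "real \<Rightarrow> real \<times> complex \<Rightarrow> real \<times> complex" and \<rho> :: "real \<Rightarrow> real"
  assume H: "\<forall>\<tau>\<in>{0..1}. \<exists>g. homeomorphism cylinder cylinder (H \<tau>) g"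
    and \<rho>: "strict_mono \<rho>" "surj \<rho>"
    and K': "curve K' = H 1 \<circ> curve K \<circ> \<rho>" "over K' = \<rho> -` over K"
  have "\<exists>g. homeomorphism cylinder cylinder (H 1) g"
    using H by (rule bspec) simp
  then obtain g where "homeomorphism cylinder cylinder (H 1) g" ..
  then have inj_H: "inj_on (H 1) cylinder"
    by (metis homeomorphism_def inj_on_inverseI)
  have in_cylinder: "curve K x \<in> cylinder" for x
    using assms(1) unfolding long_knot_diagram_def generic_immersion_def by blast
  \<comment> \<open>Composition with the injective map \<open>H 1\<close> neither creates nor
    destroys double points, so the crossings correspond under \<open>\<rho>\<close>.\<close>
  have "curve K' x = curve K' y \<longleftrightarrow> curve K (\<rho> x) = curve K (\<rho> y)" for x y
    by (simp add: K' inj_on_eq_iff[OF inj_H in_cylinder in_cylinder])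
  moreover have "inj \<rho>" using \<rho>(1) by (rule strict_mono_imp_inj_on)
  ultimately have mem: "(x, y) \<in> gauss_diagram K' \<longleftrightarrow> (\<rho> x, \<rho> y) \<in> gauss_diagram K" for x y
    by (simp add: gauss_diagram_def K'(2) inj_eq)
  have "gauss_diagram K = map_prod \<rho> \<rho> ` gauss_diagram K'"
  proof (intro equalityI subsetI)
    fix c assume c: "c \<in> gauss_diagram K"
    obtain x y where "c = (\<rho> x, \<rho> y)" using \<rho>(2) by (metis surjD surj_pair)
    then show "c \<in> map_prod \<rho> \<rho> ` gauss_diagram K'"
      using c mem[of x y] by (metis imageI map_prod_simp)
  qed (use mem in auto)
  then show ?thesis
    unfolding phi2_def using gauss_phi_image[OF \<rho>(1) gauss_like_gauss_diagram[OF assms(2)]] by simp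
qed

text \<open>A continuous injection of an interval is strictly monotone, and its value at the left
  end reveals its direction. Comparing the directions of two parametrisations thus reduces to
  comparing one boundary value.\<close>

lemma interval_bijection_direction:
  fixes f :: "real \<Rightarrow> real"
  assumes "s < t" "continuous_on {s..t} f" "bij_betw f {s..t} {a..b}" "a < b"
  defines "q \<equiv> inv_into {s..t} f"
  shows "f s = a \<or> f s = b"
    and "\<lbrakk>\<sigma> \<in> {a..b}; \<tau> \<in> {a..b}; \<sigma> < \<tau>\<rbrakk> \<Longrightarrow> q \<sigma> < q \<tau> \<longleftrightarrow> f s = a"
proof -
  have inj: "inj_on f {s..t}" and im: "f ` {s..t} = {a..b}"
    using assms(3) by (auto simp: bij_betw_def)
  have q: "q \<sigma> \<in> {s..t}" "f (q \<sigma>) = \<sigma>" if "\<sigma> \<in> {a..b}" for \<sigma>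
    using that unfolding q_def im[symmetric] by (rule inv_into_into, rule f_inv_into_f)
  have fs: "f s \<in> {a..b}" using im assms(1) by auto
  have ab: "a \<in> {a..b}" "b \<in> {a..b}" using assms(4) by auto
  consider "strict_mono_on {s..t} f" | "strict_antimono_on {s..t} f"
    using injective_eq_monotone_map[of "{s..t}" f] inj assms(2) by (auto simp: is_interval_cc)
  then have "(f s = a \<and> (\<forall>x\<in>{s..t}. \<forall>y\<in>{s..t}. f x < f y \<longleftrightarrow> x < y)) \<or>
      (f s = b \<and> (\<forall>x\<in>{s..t}. \<forall>y\<in>{s..t}. f x < f y \<longleftrightarrow> y < x))"
  proof cases
    case 1
    then have mono: "f x < f y \<longleftrightarrow> x < y" if "x \<in> {s..t}" "y \<in> {s..t}" for x y
      using that by (meson strict_mono_on_less)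
    \<comment> \<open>\<open>f s\<close> is the least value of an increasing \<open>f\<close>, and
      \<open>a\<close> is attained.\<close>
    have "\<not> f (q a) < f s" using mono[of "q a" s] q(1)[OF ab(1)] assms(1) by auto
    then have "f s = a" using q(2)[OF ab(1)] fs by simp
    then show ?thesis using mono by blast
  next
    case 2
    have anti: "f y < f x" if "x \<in> {s..t}" "y \<in> {s..t}" "x < y" for x y
      using 2 that by (auto simp: monotone_on_def)
    have anti': "f x < f y \<longleftrightarrow> y < x" if "x \<in> {s..t}" "y \<in> {s..t}" for x y
      using anti[OF that] anti[OF that(2,1)] by (cases x y rule: linorder_cases) auto
    have "\<not> f s < f (q b)" using anti'[of s "q b"] q(1)[OF ab(2)] assms(1) by auto
    then have "f s = b" using q(2)[OF ab(2)] fs by simp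
    then show ?thesis using anti' by blast
  qed
  note cases = this
  show "f s = a \<or> f s = b" using cases by blast
  show "q \<sigma> < q \<tau> \<longleftrightarrow> f s = a" if "\<sigma> \<in> {a..b}" "\<tau> \<in> {a..b}" "\<sigma> < \<tau>"
    using cases
  proof
    assume "f s = a \<and> (\<forall>x\<in>{s..t}. \<forall>y\<in>{s..t}. f x < f y \<longleftrightarrow> x < y)"
    then have "f s = a" "f (q \<sigma>) < f (q \<tau>) \<longleftrightarrow> q \<sigma> < q \<tau>" using q(1) that(1,2) by blast+
    then show ?thesis using q(2) that by simp
  next
    assume "f s = b \<and> (\<forall>x\<in>{s..t}. \<forall>y\<in>{s..t}. f x < f y \<longleftrightarrow> y < x)"
    then have "f s = b" "f (q \<sigma>) < f (q \<tau>) \<longleftrightarrow> q \<tau> < q \<sigma>" using q(1) that(1,2) by blast+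
    then show ?thesis using q(2) that assms(4) by simp
  qed
qed

text \<open>\<open>q i\<close> carries the parameters of the \<open>i\<close>-th arc to the line,
  and \<open>A\<close> stands for the set of over-endpoints. Comparing the pairs
  \<open>(i, \<sigma>)\<close> and \<open>(j, \<tau>)\<close> admits self-crossings of an
  arc.\<close>

definition local_chords ::
    "(real \<Rightarrow> real \<times> real) list \<Rightarrow> (nat \<Rightarrow> real \<Rightarrow> real) \<Rightarrow> real set \<Rightarrow> chord set" where
  "local_chords P q A = {(q i \<sigma>, q j \<tau>) | i j \<sigma> \<tau>.
     i < length P \<and> j < length P \<and> \<sigma> \<in> {-2..2} \<and> \<tau> \<in> {-2..2} \<and> (i, \<sigma>) \<noteq> (j, \<tau>) \<and>
     (P ! i) \<sigma> = (P ! j) \<tau> \<and> q i \<sigma> \<in> A}"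

lemma mem_std_disc: "(a, b) \<in> std_disc \<longleftrightarrow> a \<in> {-2..2} \<and> b \<in> {-4..4}"
  by (simp add: std_disc_def cbox_Pair_iff)

lemma frontier_std_disc: "z \<in> std_disc \<Longrightarrow> fst z = -2 \<or> fst z = 2 \<Longrightarrow> z \<in> frontier std_disc"
  by (cases z) (auto simp: std_disc_def frontier_cbox mem_box Basis_prod_def)

text \<open>What remains once the homeomorphism onto the disc is forgotten: the double points of
  \<open>P\<close>, transported to the line by \<open>q\<close>. Heights decide crossings of
  different arcs; \<open>over_iff\<close> also covers self-crossings, of which it is only known that
  exactly one end is over.\<close>

locale local_picture =
  fixes P :: "(real \<Rightarrow> real \<times> real) list" and K :: diagram and C :: "chord set"
    and s t :: "nat \<Rightarrow> real" and q :: "nat \<Rightarrow> real \<Rightarrow> real" and h :: "nat \<Rightarrow> nat"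
  assumes gauss_like: "gauss_like (gauss_diagram K)"
    and chords: "gauss_diagram K = C \<union> local_chords P q (over K)"
    and outside: "endpoints C \<inter> (\<Union>i<length P. {s i..t i}) = {}"
    and disjoint: "\<And>i j. i < length P \<Longrightarrow> j < length P \<Longrightarrow> i \<noteq> j \<Longrightarrow> {s i..t i} \<inter> {s j..t j} = {}"
    and param: "\<And>i \<tau>. i < length P \<Longrightarrow> \<tau> \<in> {-2..2} \<Longrightarrow> q i \<tau> \<in> {s i..t i}"
    and param_inj: "\<And>i \<sigma> \<tau>. i < length P \<Longrightarrow> \<sigma> \<in> {-2..2} \<Longrightarrow> \<tau> \<in> {-2..2} \<Longrightarrow> q i \<sigma> = q i \<tau> \<Longrightarrow> \<sigma> = \<tau>"
    and over_iff: "\<And>i j \<sigma> \<tau>. \<lbrakk>i < length P; j < length P; \<sigma> \<in> {-2..2}; \<tau> \<in> {-2..2};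
      (P ! i) \<sigma> = (P ! j) \<tau>; (i, \<sigma>) \<noteq> (j, \<tau>)\<rbrakk> \<Longrightarrow> q i \<sigma> \<in> over K \<longleftrightarrow> q j \<tau> \<notin> over K"
    and over_height: "\<And>i j \<sigma> \<tau>. \<lbrakk>i < length P; j < length P; \<sigma> \<in> {-2..2}; \<tau> \<in> {-2..2};
      (P ! i) \<sigma> = (P ! j) \<tau>; i \<noteq> j\<rbrakk> \<Longrightarrow> q i \<sigma> \<in> over K \<longleftrightarrow> h j < h i"

text \<open>The preimage of \<open>E\<close> is the union of the intervals, so the two ends of a
  crossing are both inside or both outside. Injectivity of \<open>e\<close> identifies the crossings
  inside with the double points of the picture.\<close>

lemma local_picture_of_arcs:
  assumes K: "long_knot_diagram pt K"
    and inj: "inj_on e std_disc"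
    and disc: "\<And>i \<tau>. i < length P \<Longrightarrow> \<tau> \<in> {-2..2} \<Longrightarrow> (P ! i) \<tau> \<in> std_disc"
    and disjoint: "\<And>i j. i < length P \<Longrightarrow> j < length P \<Longrightarrow> i \<noteq> j \<Longrightarrow> {s i..t i} \<inter> {s j..t j} = {}"
    and U: "curve K -` E = (\<Union>i<length P. {s i..t i})"
    and bij: "\<And>i. i < length P \<Longrightarrow> bij_betw (\<psi> i) {s i..t i} {-2..2}"
    and arc: "\<And>i x. i < length P \<Longrightarrow> x \<in> {s i..t i} \<Longrightarrow> curve K x = e ((P ! i) (\<psi> i x))"
    and h: "inj_on h {..<length P}"
    and height: "\<And>i j x y. \<lbrakk>i < length P; j < length P; x \<in> {s i..t i}; y \<in> {s j..t j}; h j < h i;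
      curve K x = curve K y\<rbrakk> \<Longrightarrow> x \<in> over K"
  shows "local_picture P K {(x, y) \<in> gauss_diagram K. x \<notin> (\<Union>i<length P. {s i..t i})} s t
    (\<lambda>i. inv_into {s i..t i} (\<psi> i)) h"
proof -
  define q where "q i = inv_into {s i..t i} (\<psi> i)" for i
  define A where "A = (\<Union>i<length P. {s i..t i})"
  have q_eq: "(\<lambda>i. inv_into {s i..t i} (\<psi> i)) = q" by (simp add: q_def fun_eq_iff)
  have q: "q i \<tau> \<in> {s i..t i}" "\<psi> i (q i \<tau>) = \<tau>" if "i < length P" "\<tau> \<in> {-2..2}" for i \<tau>
  proof -
    have "\<tau> \<in> \<psi> i ` {s i..t i}" using bij[OF that(1)] that(2) by (simp add: bij_betw_def)
    then show "q i \<tau> \<in> {s i..t i}" "\<psi> i (q i \<tau>) = \<tau>"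
      unfolding q_def by (rule inv_into_into, rule f_inv_into_f)
  qed
  have \<psi>: "\<psi> i x \<in> {-2..2}" "q i (\<psi> i x) = x" if "i < length P" "x \<in> {s i..t i}" for i x
  proof -
    show "\<psi> i x \<in> {-2..2}" by (rule bij_betwE[OF bij[OF that(1)], rule_format, OF that(2)])
    show "q i (\<psi> i x) = x"
      unfolding q_def by (rule inv_into_f_f[OF bij_betw_imp_inj_on[OF bij[OF that(1)]] that(2)])
  qed
  have q_inj: "\<sigma> = \<tau>" if "i < length P" "\<sigma> \<in> {-2..2}" "\<tau> \<in> {-2..2}" "q i \<sigma> = q i \<tau>" for i \<sigma> \<tau>
    using q(2)[OF that(1,2)] q(2)[OF that(1,3)] that(4) by metis
  have curve_eq: "curve K (q i \<sigma>) = curve K (q j \<tau>)"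
    if "i < length P" "j < length P" "\<sigma> \<in> {-2..2}" "\<tau> \<in> {-2..2}" "(P ! i) \<sigma> = (P ! j) \<tau>" for i j \<sigma> \<tau>
    using arc[OF that(1) q(1)[OF that(1,3)]] arc[OF that(2) q(1)[OF that(2,4)]]
      q(2)[OF that(1,3)] q(2)[OF that(2,4)] that(5) by simp
  have q_noteq: "q i \<sigma> \<noteq> q j \<tau>"
    if "i < length P" "j < length P" "\<sigma> \<in> {-2..2}" "\<tau> \<in> {-2..2}" "(i, \<sigma>) \<noteq> (j, \<tau>)" for i j \<sigma> \<tau>
  proof (cases "i = j")
    case True
    then show ?thesis using q_inj[OF that(1,3)] that by blast
  next
    case False
    then show ?thesis
      using disjoint_imp_noteq[OF disjoint[OF that(1,2)] q(1)[OF that(1,3)] q(1)[OF that(2,4)]] by blast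
  qed
  have inside: "{(x, y) \<in> gauss_diagram K. x \<in> (\<Union>i<length P. {s i..t i})} = local_chords P q (over K)"
  proof (intro equalityI subsetI)
    fix c assume "c \<in> {(x, y) \<in> gauss_diagram K. x \<in> (\<Union>i<length P. {s i..t i})}"
    moreover obtain x y where xy: "c = (x, y)" by fastforce
    ultimately have "x \<in> (\<Union>i<length P. {s i..t i})" and
      c: "x \<noteq> y" "curve K x = curve K y" "x \<in> over K"
      unfolding gauss_diagram_def by (simp_all only: mem_Collect_eq case_prod_conv not_False_eq_True)
    then obtain i where i: "i < length P" "x \<in> {s i..t i}" by blast
    have "x \<in> curve K -` E" unfolding U using i by blast
    then have "y \<in> curve K -` E" using c(2) by simp
    then obtain j where j: "j < length P" "y \<in> {s j..t j}" unfolding U by blast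
    have "(P ! i) (\<psi> i x) = (P ! j) (\<psi> j y)"
    proof (rule inj_onD[OF inj])
      show "e ((P ! i) (\<psi> i x)) = e ((P ! j) (\<psi> j y))"
        using c(2) arc[OF i] arc[OF j] by simp
    qed (rule disc[OF i(1) \<psi>(1)[OF i]], rule disc[OF j(1) \<psi>(1)[OF j]])
    moreover have "(i, \<psi> i x) \<noteq> (j, \<psi> j y)"
      using c(1) \<psi>(2)[OF i] \<psi>(2)[OF j] by auto
    ultimately show "c \<in> local_chords P q (over K)"
      unfolding local_chords_def mem_Collect_eq
      using xy c i j \<psi>[OF i] \<psi>[OF j]
      by (intro exI[of _ i] exI[of _ j] exI[of _ "\<psi> i x"] exI[of _ "\<psi> j y"]) simp
  next
    fix c assume "c \<in> local_chords P q (over K)"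
    then obtain i j \<sigma> \<tau> where c: "c = (q i \<sigma>, q j \<tau>)" and ij: "i < length P" "j < length P"
      and \<sigma>: "\<sigma> \<in> {-2..2}" "\<tau> \<in> {-2..2}" "(i, \<sigma>) \<noteq> (j, \<tau>)" "(P ! i) \<sigma> = (P ! j) \<tau>"
      and over: "q i \<sigma> \<in> over K"
      unfolding local_chords_def by blast
    have "q i \<sigma> \<noteq> q j \<tau>" by (rule q_noteq[OF ij \<sigma>(1-3)])
    moreover have "q i \<sigma> \<in> (\<Union>i<length P. {s i..t i})"
      using q(1)[OF ij(1) \<sigma>(1)] ij(1) by blast
    ultimately show "c \<in> {(x, y) \<in> gauss_diagram K. x \<in> (\<Union>i<length P. {s i..t i})}"
      unfolding c gauss_diagram_def mem_Collect_eq case_prod_conv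
      by (intro conjI over curve_eq[OF ij \<sigma>(1,2,4)])
  qed
  have over_iff: "q i \<sigma> \<in> over K \<longleftrightarrow> q j \<tau> \<notin> over K"
    if "i < length P" "j < length P" "\<sigma> \<in> {-2..2}" "\<tau> \<in> {-2..2}" "(P ! i) \<sigma> = (P ! j) \<tau>"
      "(i, \<sigma>) \<noteq> (j, \<tau>)" for i j \<sigma> \<tau>
    by (rule long_knot_over[OF K q_noteq[OF that(1-4,6)] curve_eq[OF that(1-5)]])
  have "local_picture P K {(x, y) \<in> gauss_diagram K. x \<notin> A} s t q h"
  proof
    show "gauss_like (gauss_diagram K)" by (rule gauss_like_gauss_diagram[OF K])
    have "gauss_diagram K = {(x, y) \<in> gauss_diagram K. x \<notin> A} \<union> {(x, y) \<in> gauss_diagram K. x \<in> A}"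
      by auto
    then show "gauss_diagram K = {(x, y) \<in> gauss_diagram K. x \<notin> A} \<union> local_chords P q (over K)"
      using inside unfolding A_def by simp
    have "x \<notin> A \<and> y \<notin> A" if "(x, y) \<in> gauss_diagram K" "x \<notin> A" for x y
      using that unfolding A_def U[symmetric] by (simp add: gauss_diagram_def)
    then show "endpoints {(x, y) \<in> gauss_diagram K. x \<notin> A} \<inter> (\<Union>i<length P. {s i..t i}) = {}"
      unfolding A_def[symmetric] endpoints_def by auto
    show "q i \<sigma> \<in> over K \<longleftrightarrow> h j < h i"
      if "i < length P" "j < length P" "\<sigma> \<in> {-2..2}" "\<tau> \<in> {-2..2}" "(P ! i) \<sigma> = (P ! j) \<tau>" "i \<noteq> j"
      for i j \<sigma> \<tau>
    proof -
      have eq: "curve K (q i \<sigma>) = curve K (q j \<tau>)" by (rule curve_eq[OF that(1-5)])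
      \<comment> \<open>One of the two arcs is strictly higher and hence over; then the other is not
        over, which turns the implication in \<open>height\<close> into an equivalence.\<close>
      have "h i \<noteq> h j" using h that(1,2,6) by (auto simp: inj_on_def)
      moreover have "h j < h i \<Longrightarrow> q i \<sigma> \<in> over K"
        using height[OF that(1,2) q(1)[OF that(1,3)] q(1)[OF that(2,4)] _ eq] .
      moreover have "h i < h j \<Longrightarrow> q j \<tau> \<in> over K"
        using height[OF that(2,1) q(1)[OF that(2,4)] q(1)[OF that(1,3)] _ eq[symmetric]] .
      moreover have "q i \<sigma> \<in> over K \<longleftrightarrow> q j \<tau> \<notin> over K"
        using over_iff[OF that(1-5)] that(6) by simp
      ultimately show ?thesis by linarith
    qed
  qed (rule disjoint q q_inj over_iff; assumption)+
  then show ?thesis unfolding A_def q_eq .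
qed

text \<open>The last conclusion says that each arc is traversed in the same direction before and
  after, which makes the orders of the crossings comparable. It holds because both curves enter the
  disc at the same point of its boundary, where \<open>e\<close> and \<open>e'\<close> agree;
  \<open>ends\<close> and \<open>ends'\<close> recover the parameter from that point.\<close>

lemma local_moveE:
  assumes move: "local_move P P' K K'"
    and K: "long_knot_diagram pt K" and K': "long_knot_diagram pt K'"
    and disc: "\<And>i \<tau>. i < length P \<Longrightarrow> \<tau> \<in> {-2..2} \<Longrightarrow> (P ! i) \<tau> \<in> std_disc"
    and disc': "\<And>i \<tau>. i < length P' \<Longrightarrow> \<tau> \<in> {-2..2} \<Longrightarrow> (P' ! i) \<tau> \<in> std_disc"
    and ends: "\<And>i \<tau>. i < length P \<Longrightarrow> \<tau> = -2 \<or> \<tau> = 2 \<Longrightarrow> fst ((P ! i) \<tau>) = \<tau>"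
    and ends': "\<And>i \<tau>. i < length P' \<Longrightarrow> \<tau> = -2 \<or> \<tau> = 2 \<Longrightarrow> fst ((P' ! i) \<tau>) = \<tau>"
  obtains C s t q q' h where "local_picture P K C s t q h" "local_picture P' K' C s t q' h"
    "\<And>i \<sigma> \<tau> \<sigma>' \<tau>'. \<lbrakk>i < length P; \<sigma> \<in> {-2..2}; \<tau> \<in> {-2..2}; \<sigma>' \<in> {-2..2}; \<tau>' \<in> {-2..2}; \<sigma> < \<tau>; \<sigma>' < \<tau>'\<rbrakk>
      \<Longrightarrow> q i \<sigma> < q i \<tau> \<longleftrightarrow> q' i \<sigma>' < q' i \<tau>'"
  using move unfolding local_move_def Let_def
proof (elim exE conjE)
  fix E e e' g g' s t \<psi> \<psi>' and h :: "nat \<Rightarrow> nat"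
  assume len: "length P = length P'"
    and e: "homeomorphism std_disc E e g" and e': "homeomorphism std_disc E e' g'"
    and boundary: "\<forall>z\<in>frontier std_disc. e z = e' z"
    and st: "\<forall>i\<in>{..<length P}. s i < t i"
    and dis: "\<forall>i\<in>{..<length P}. \<forall>j\<in>{..<length P}. i \<noteq> j \<longrightarrow> {s i..t i} \<inter> {s j..t j} = {}"
    and U: "curve K -` E = (\<Union>i\<in>{..<length P}. {s i..t i})"
    and U': "curve K' -` E = (\<Union>i\<in>{..<length P}. {s i..t i})"
    and curve_eq: "\<forall>x. x \<notin> (\<Union>i\<in>{..<length P}. {s i<..<t i}) \<longrightarrow> curve K x = curve K' x"
    and over_eq: "\<forall>x. x \<notin> (\<Union>i\<in>{..<length P}. {s i..t i}) \<longrightarrow> (x \<in> over K \<longleftrightarrow> x \<in> over K')"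
    and \<psi>: "\<forall>i\<in>{..<length P}. continuous_on {s i..t i} (\<psi> i) \<and> bij_betw (\<psi> i) {s i..t i} {-2..2} \<and>
        (\<forall>x\<in>{s i..t i}. curve K x = e ((P ! i) (\<psi> i x)))"
    and \<psi>': "\<forall>i\<in>{..<length P}. continuous_on {s i..t i} (\<psi>' i) \<and> bij_betw (\<psi>' i) {s i..t i} {-2..2} \<and>
        (\<forall>x\<in>{s i..t i}. curve K' x = e' ((P' ! i) (\<psi>' i x)))"
    and h: "inj_on h {..<length P}"
    and height: "\<forall>i\<in>{..<length P}. \<forall>j\<in>{..<length P}. \<forall>x\<in>{s i..t i}. \<forall>y\<in>{s j..t j}. h j < h i \<longrightarrow>
        (curve K x = curve K y \<longrightarrow> x \<in> over K) \<and> (curve K' x = curve K' y \<longrightarrow> x \<in> over K')"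
  let ?A = "\<Union>i<length P. {s i..t i}"
  let ?q = "\<lambda>i. inv_into {s i..t i} (\<psi> i)" and ?q' = "\<lambda>i. inv_into {s i..t i} (\<psi>' i)"
  have inj: "inj_on e std_disc" "inj_on e' std_disc"
    using e e' by (metis homeomorphism_def inj_on_inverseI)+
  have bij: "bij_betw (\<psi> i) {s i..t i} {-2..2}" "bij_betw (\<psi>' i) {s i..t i} {-2..2}"
    and cont: "continuous_on {s i..t i} (\<psi> i)" "continuous_on {s i..t i} (\<psi>' i)"
    and arc: "\<And>x. x \<in> {s i..t i} \<Longrightarrow> curve K x = e ((P ! i) (\<psi> i x))"
      "\<And>x. x \<in> {s i..t i} \<Longrightarrow> curve K' x = e' ((P' ! i) (\<psi>' i x))" if "i < length P" for i
    using \<psi> \<psi>' that by blast+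
  have dis': "{s i..t i} \<inter> {s j..t j} = {}" if "i < length P" "j < length P" "i \<noteq> j" for i j
    using dis that by blast
  have height': "curve K x = curve K y \<Longrightarrow> x \<in> over K"
    and height'': "curve K' x = curve K' y \<Longrightarrow> x \<in> over K'"
    if "i < length P" "j < length P" "x \<in> {s i..t i}" "y \<in> {s j..t j}" "h j < h i" for i j x y
    using height that by blast+
  have start: "\<psi>' i (s i) = \<psi> i (s i)" if i: "i < length P" for i
  proof -
    have sti: "s i < t i" using st i by blast
    then have s_mem: "s i \<in> {s i..t i}" by simp
    \<comment> \<open>The curves agree off the open intervals, hence also at the left end
      \<open>s i\<close>.\<close>
    have "s i \<notin> {s j<..<t j}" if "j < length P" for j
    proof (cases "j = i")
      case False
      then have "s i \<notin> {s j..t j}" using dis i that s_mem by blast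
      then show ?thesis by auto
    qed simp
    then have "curve K (s i) = curve K' (s i)" using curve_eq by blast
    then have eq: "e ((P ! i) (\<psi> i (s i))) = e' ((P' ! i) (\<psi>' i (s i)))"
      using arc[OF i s_mem] by simp
    have start: "\<psi> i (s i) = -2 \<or> \<psi> i (s i) = 2" "\<psi>' i (s i) = -2 \<or> \<psi>' i (s i) = 2"
      using interval_bijection_direction(1)[OF sti cont(1)[OF i] bij(1)[OF i]]
        interval_bijection_direction(1)[OF sti cont(2)[OF i] bij(2)[OF i]] by simp_all
    then have mem: "\<psi> i (s i) \<in> {-2..2}" "\<psi>' i (s i) \<in> {-2..2}" by auto
    have i': "i < length P'" using i len by simp
    \<comment> \<open>A parameter \<open>-2\<close> or \<open>2\<close> lies on a vertical side of
      the disc. There \<open>e'\<close> may be replaced by \<open>e\<close>, whose injectivity then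
      compares the two pictures.\<close>
    have "(P' ! i) (\<psi>' i (s i)) \<in> frontier std_disc"
      using frontier_std_disc[OF disc'[OF i' mem(2)]] ends'[OF i' start(2)] start(2) by simp
    then have "e ((P ! i) (\<psi> i (s i))) = e ((P' ! i) (\<psi>' i (s i)))"
      using eq boundary by simp
    then have "(P ! i) (\<psi> i (s i)) = (P' ! i) (\<psi>' i (s i))"
      by (rule inj_onD[OF inj(1) _ disc[OF i mem(1)] disc'[OF i' mem(2)]])
    then show ?thesis using ends[OF i start(1)] ends'[OF i' start(2)] by simp
  qed
  have common: "{(x, y) \<in> gauss_diagram L. x \<notin> ?A} \<subseteq> {(x, y) \<in> gauss_diagram L'. x \<notin> ?A}"
    if "curve L -` E = ?A" "\<And>x. x \<notin> ?A \<Longrightarrow> curve L x = curve L' x"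
      "\<And>x. x \<notin> ?A \<Longrightarrow> x \<in> over L \<longleftrightarrow> x \<in> over L'" for L L'
  proof (rule subsetI)
    fix c assume "c \<in> {(x, y) \<in> gauss_diagram L. x \<notin> ?A}"
    moreover obtain x y where c: "c = (x, y)" by fastforce
    ultimately have xy: "x \<noteq> y" "curve L x = curve L y" "x \<in> over L" "x \<notin> ?A"
      unfolding gauss_diagram_def by (simp_all only: mem_Collect_eq case_prod_conv not_False_eq_True)
    then have "y \<notin> ?A" unfolding that(1)[symmetric] by simp
    then show "c \<in> {(x, y) \<in> gauss_diagram L'. x \<notin> ?A}"
      using xy that(2,3)[of x] that(2)[of y]
      unfolding c gauss_diagram_def by (simp only: mem_Collect_eq case_prod_conv simp_thms)
  qed
  have curve_outside: "curve K x = curve K' x" if "x \<notin> ?A" for x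
  proof -
    have "x \<notin> (\<Union>i\<in>{..<length P}. {s i<..<t i})" using that by fastforce
    then show ?thesis using curve_eq by blast
  qed
  have C_eq: "{(x, y) \<in> gauss_diagram K. x \<notin> ?A} = {(x, y) \<in> gauss_diagram K'. x \<notin> ?A}"
  proof
    show "{(x, y) \<in> gauss_diagram K. x \<notin> ?A} \<subseteq> {(x, y) \<in> gauss_diagram K'. x \<notin> ?A}"
      by (rule common[OF U curve_outside]) (use over_eq in blast)+
    show "{(x, y) \<in> gauss_diagram K'. x \<notin> ?A} \<subseteq> {(x, y) \<in> gauss_diagram K. x \<notin> ?A}"
      by (rule common[OF U' curve_outside[symmetric]]) (use over_eq in blast)+
  qed
  show thesis
  proof (rule that)
    show "local_picture P K {(x, y) \<in> gauss_diagram K. x \<notin> ?A} s t ?q h"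
      by (rule local_picture_of_arcs[where pt = pt and e = e and E = E])
        (rule K inj(1) disc U bij(1) arc(1) h dis' height'; assumption)+
    show "local_picture P' K' {(x, y) \<in> gauss_diagram K. x \<notin> ?A} s t ?q' h"
      unfolding C_eq unfolding len
      by (rule local_picture_of_arcs[where pt = pt and e = e' and E = E]; (unfold len[symmetric])?)
        (rule K' inj(2) disc'[folded len] U' bij(2) arc(2) h dis' height''; assumption)+
    show "?q i \<sigma> < ?q i \<tau> \<longleftrightarrow> ?q' i \<sigma>' < ?q' i \<tau>'"
      if "i < length P" "\<sigma> \<in> {-2..2}" "\<tau> \<in> {-2..2}" "\<sigma>' \<in> {-2..2}" "\<tau>' \<in> {-2..2}" "\<sigma> < \<tau>" "\<sigma>' < \<tau>'"
      for i \<sigma> \<tau> \<sigma>' \<tau>'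
    proof -
      have "s i < t i" using st that(1) by blast
      then show ?thesis
        using interval_bijection_direction(2)[OF _ cont(1) bij(1) _ that(2,3,6)]
          interval_bijection_direction(2)[OF _ cont(2) bij(2) _ that(4,5,7)] that(1) start by simp
    qed
  qed
qed

text \<open>Arcs that are graphs over the first coordinate can meet only at equal parameters. They
  have no self-crossings, and each double point is given by a pair \<open>i < j\<close> and one
  parameter. The kink of the first move is not of this form.\<close>

lemma (in local_picture) local_chords_graph:
  assumes graph: "\<And>i \<tau>. i < length P \<Longrightarrow> fst ((P ! i) \<tau>) = \<tau>"
  shows "local_chords P q (over K) = {mk_chord (h j < h i) (q i \<tau>) (q j \<tau>) | i j \<tau>.
    i < j \<and> j < length P \<and> \<tau> \<in> {-2..2} \<and> snd ((P ! i) \<tau>) = snd ((P ! j) \<tau>)}" (is "_ = ?R")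
proof (intro equalityI subsetI)
  fix c assume "c \<in> local_chords P q (over K)"
  then obtain i j \<sigma> \<tau> where c: "c = (q i \<sigma>, q j \<tau>)" and ij: "i < length P" "j < length P"
    and \<sigma>: "\<sigma> \<in> {-2..2}" "\<tau> \<in> {-2..2}" "(i, \<sigma>) \<noteq> (j, \<tau>)" "(P ! i) \<sigma> = (P ! j) \<tau>"
    and over: "q i \<sigma> \<in> over K"
    unfolding local_chords_def by blast
  have "\<sigma> = \<tau>" using graph[OF ij(1), of \<sigma>] graph[OF ij(2), of \<tau>] \<sigma>(4) by metis
  then have "i \<noteq> j" using \<sigma>(3) by blast
  then have h: "h j < h i" using over over_height[OF ij \<sigma>(1,2,4)] by blast
  show "c \<in> ?R"
  proof (cases "i < j")
    case True
    then show ?thesis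
      unfolding mem_Collect_eq using c h \<sigma> ij \<open>\<sigma> = \<tau>\<close>
      by (intro exI[of _ i] exI[of _ j] exI[of _ \<tau>]) (simp add: mk_chord_def)
  next
    case False
    then show ?thesis
      unfolding mem_Collect_eq using c h \<sigma> ij \<open>\<sigma> = \<tau>\<close> \<open>i \<noteq> j\<close>
      by (intro exI[of _ j] exI[of _ i] exI[of _ \<tau>]) (simp add: mk_chord_def)
  qed
next
  fix c assume "c \<in> ?R"
  then obtain i j \<tau> where c: "c = mk_chord (h j < h i) (q i \<tau>) (q j \<tau>)" and ij: "i < j" "j < length P"
    and \<tau>: "\<tau> \<in> {-2..2}" "snd ((P ! i) \<tau>) = snd ((P ! j) \<tau>)"
    by blast
  have ij': "i < length P" "i \<noteq> j" using ij by auto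
  have eq: "(P ! i) \<tau> = (P ! j) \<tau>"
    using \<tau>(2) graph[OF ij'(1), of \<tau>] graph[OF ij(2), of \<tau>] by (simp add: prod_eq_iff)
  have "q i \<tau> \<in> over K \<longleftrightarrow> h j < h i" "q j \<tau> \<in> over K \<longleftrightarrow> h i < h j"
    using over_height[OF ij'(1) ij(2) \<tau>(1,1) eq ij'(2)]
      over_height[OF ij(2) ij'(1) \<tau>(1,1) eq[symmetric]] ij'(2) by blast+
  moreover have "q i \<tau> \<in> over K \<longleftrightarrow> q j \<tau> \<notin> over K"
    using over_iff[OF ij'(1) ij(2) \<tau>(1,1) eq] ij'(2) by simp
  ultimately show "c \<in> local_chords P q (over K)"
    unfolding c local_chords_def mem_Collect_eq
    using ij' ij(2) \<tau>(1) eq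
    by (cases "h j < h i")
      (rule exI[of _ i], rule exI[of _ j], rule exI[of _ \<tau>], rule exI[of _ \<tau>], simp add: mk_chord_def,
       rule exI[of _ j], rule exI[of _ i], rule exI[of _ \<tau>], rule exI[of _ \<tau>], simp add: mk_chord_def)
qed

section \<open>Double points of the pictures of the three moves\<close>

lemma index_pairs_two:
  "{f i j x | i j x. i < j \<and> j < (2::nat) \<and> R i j x} = {f 0 1 x | x. R 0 1 x}"
proof -
  have "i < j \<and> j < 2 \<and> S \<longleftrightarrow> i = 0 \<and> j = 1 \<and> S" for i j :: nat and S by auto
  then show ?thesis by simp
qed

lemma index_pairs_three:
  "{f i j x | i j x. i < j \<and> j < (3::nat) \<and> R i j x}
    = {f 0 1 x | x. R 0 1 x} \<union> {f 0 2 x | x. R 0 2 x} \<union> {f 1 2 x | x. R 1 2 x}"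
proof -
  have "i < j \<and> j < 3 \<and> S \<longleftrightarrow> i = 0 \<and> j = 1 \<and> S \<or> i = 0 \<and> j = 2 \<and> S \<or> i = 1 \<and> j = 2 \<and> S"
    for i j :: nat and S by auto
  then show ?thesis by (simp add: conj_disj_distribL ex_disj_distrib Collect_disj_eq Un_assoc)
qed

lemma square_bounds: "0 \<le> x^2" "x^2 \<le> 4" if "x \<in> {-2..2}" for x :: real
  using that power2_le_iff_abs_le[of 2 x] by auto

lemma phi2_R1:
  assumes K: "long_knot_diagram pt K" and K': "long_knot_diagram pt K'" and "R1 K K'"
  shows "phi2 K = phi2 K'"
proof -
  let ?P = "[\<lambda>\<tau>. (\<tau>, 3)] :: (real \<Rightarrow> real \<times> real) list"
  let ?P' = "[\<lambda>\<tau>. ((\<tau>^3 - \<tau>) / 3, \<tau>^2 - 1)] :: (real \<Rightarrow> real \<times> real) list"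
  have move: "local_move ?P ?P' K K'" using assms(3) by (simp add: R1_def)
  have "((\<tau>^3 - \<tau>) / 3, \<tau>^2 - 1) \<in> std_disc" if "\<tau> \<in> {-2..2}" for \<tau> :: real
  proof -
    \<comment> \<open>These are factorisations of \<open>6 - z\<close> and \<open>6 + z\<close> for
      \<open>z = \<tau>^3 - \<tau>\<close>; the bound 6 is the half-width 2 of the disc times the
      denominator 3.\<close>
    have "(2 - \<tau>) * ((\<tau> + 1)^2 + 2) \<ge> 0" "(\<tau> + 2) * ((\<tau> - 1)^2 + 2) \<ge> 0"
      using that by (intro mult_nonneg_nonneg; simp)+
    moreover define y z where "y = \<tau>^2" and "z = \<tau>^3 - \<tau>"
    ultimately have "z \<le> 6" "-6 \<le> z"
      by (simp_all add: power2_eq_square power3_eq_cube algebra_simps)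
    moreover have "0 \<le> y" "y \<le> 4" unfolding y_def by (rule square_bounds[OF that])+
    ultimately show ?thesis
      by (simp add: mem_std_disc flip: y_def z_def)
  qed
  then obtain C s t q q' h where "local_picture ?P K C s t q h" "local_picture ?P' K' C s t q' h"
    by - (rule local_moveE[OF move K K'], auto simp: mem_std_disc)
  then interpret A: local_picture ?P K C s t q h + B: local_picture ?P' K' C s t q' h .
  have "local_chords ?P q (over K) = {}"
    by (subst A.local_chords_graph) auto
  then have G: "gauss_diagram K = C" using A.chords by simp
  let ?x = "q' 0 1" and ?y = "q' 0 (- 1)"
  \<comment> \<open>Equal squares force opposite parameters, where the odd cubic takes opposite
    values and so must vanish; 0 is excluded because it is its own opposite.\<close>
  have node: "\<sigma> = 1 \<and> \<tau> = -1 \<or> \<sigma> = -1 \<and> \<tau> = 1"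
    if "\<sigma>^3 - \<sigma> = \<tau>^3 - \<tau>" "\<sigma>^2 = \<tau>^2" "\<sigma> \<noteq> \<tau>" for \<sigma> \<tau> :: real
  proof -
    have \<tau>: "\<tau> = - \<sigma>" using that(2,3) by (auto simp: power2_eq_iff)
    then have "\<sigma> * (\<sigma>^2 - 1) = 0" using that(1) by (simp add: power3_eq_cube power2_eq_square algebra_simps)
    moreover have "\<sigma> \<noteq> 0" using \<tau> that(3) by auto
    ultimately have "\<sigma>^2 = 1" by simp
    then show ?thesis using \<tau> by (auto simp: power2_eq_1_iff)
  qed
  \<comment> \<open>Both ends lie on the same arc, so heights say nothing and the flag of the chord
    is read off from \<open>over K'\<close>.\<close>
  have over: "?x \<in> over K' \<longleftrightarrow> ?y \<notin> over K'"
    using B.over_iff[of 0 0 1 "-1"] by simp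
  have "local_chords ?P' q' (over K') = {mk_chord (?x \<in> over K') ?x ?y}"
  proof (intro equalityI subsetI)
    fix c assume "c \<in> local_chords ?P' q' (over K')"
    then obtain \<sigma> \<tau> where c: "c = (q' 0 \<sigma>, q' 0 \<tau>)" "q' 0 \<sigma> \<in> over K'"
      and "\<sigma>^3 - \<sigma> = \<tau>^3 - \<tau>" "\<sigma>^2 = \<tau>^2" "\<sigma> \<noteq> \<tau>"
      by (auto simp: local_chords_def)
    then have "\<sigma> = 1 \<and> \<tau> = -1 \<or> \<sigma> = -1 \<and> \<tau> = 1" by (intro node)
    then show "c \<in> {mk_chord (?x \<in> over K') ?x ?y}"
      using c over by (auto simp: mk_chord_def)
  next
    fix c assume "c \<in> {mk_chord (?x \<in> over K') ?x ?y}"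
    then have c: "c = (if ?x \<in> over K' then (?x, ?y) else (?y, ?x))" by (simp add: mk_chord_def)
    show "c \<in> local_chords ?P' q' (over K')"
    proof (cases "?x \<in> over K'")
      case True
      then show ?thesis unfolding local_chords_def c mem_Collect_eq
        by (intro exI[of _ 0] exI[of _ 1] exI[of _ "-1"]) simp
    next
      case False
      then show ?thesis unfolding local_chords_def c mem_Collect_eq using over
        by (intro exI[of _ 0] exI[of _ "-1"] exI[of _ 1]) simp
    qed
  qed
  then have G': "gauss_diagram K' = C \<union> {mk_chord (?x \<in> over K') ?x ?y}"
    using B.chords by simp
  have "gauss_phi C = gauss_phi (C \<union> {mk_chord (?x \<in> over K') ?x ?y})"
  proof (rule gauss_phi_R1)
    show "gauss_like C" using A.gauss_like G by simp
    show "gauss_like (C \<union> {mk_chord (?x \<in> over K') ?x ?y})" using B.gauss_like G' by simp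
    show "endpoints C \<inter> {s 0..t 0} = {}" using B.outside by (simp add: lessThan_Suc)
    show "?x \<in> {s 0..t 0}" "?y \<in> {s 0..t 0}" by (rule B.param; simp)+
    show "?x \<noteq> ?y" using B.param_inj[of 0 1 "-1"] by auto
  qed
  then show ?thesis by (simp add: phi2_def G G')
qed

lemma phi2_R2:
  assumes K: "long_knot_diagram pt K" and K': "long_knot_diagram pt K'" and "R2 K K'"
  shows "phi2 K = phi2 K'"
proof -
  let ?P = "[\<lambda>\<tau>. (\<tau>, 3), \<lambda>\<tau>. (\<tau>, -3)] :: (real \<Rightarrow> real \<times> real) list"
  let ?P' = "[\<lambda>\<tau>. (\<tau>, \<tau>^2 - 1), \<lambda>\<tau>. (\<tau>, 1 - \<tau>^2)] :: (real \<Rightarrow> real \<times> real) list"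
  have move: "local_move ?P ?P' K K'" using assms(3) by (simp add: R2_def)
  have "(\<tau>, 3) \<in> std_disc" "(\<tau>, -3) \<in> std_disc"
    "(\<tau>, \<tau>^2 - 1) \<in> std_disc" "(\<tau>, 1 - \<tau>^2) \<in> std_disc" if "\<tau> \<in> {-2..2}" for \<tau> :: real
  proof -
    define y where "y = \<tau>^2"
    have "0 \<le> y" "y \<le> 4" unfolding y_def by (rule square_bounds[OF that])+
    then show "(\<tau>, 3) \<in> std_disc" "(\<tau>, -3) \<in> std_disc"
      "(\<tau>, \<tau>^2 - 1) \<in> std_disc" "(\<tau>, 1 - \<tau>^2) \<in> std_disc"
      using that by (simp_all add: mem_std_disc field_simps flip: y_def)
  qed
  then obtain C s t q q' h where "local_picture ?P K C s t q h" "local_picture ?P' K' C s t q' h"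
    by - (rule local_moveE[OF move K K'], auto simp: less_Suc_eq simp del: atLeastAtMost_iff)
  then interpret A: local_picture ?P K C s t q h + B: local_picture ?P' K' C s t q' h .
  have "local_chords ?P q (over K) = {}"
    by (subst A.local_chords_graph) (auto simp: less_Suc_eq)
  then have G: "gauss_diagram K = C" using A.chords by simp
  \<comment> \<open>Heights belong to arcs and not to crossings, so both vertices of the bigon
    receive the same flag.\<close>
  let ?w = "h 1 < h 0"
  let ?M = "{mk_chord ?w (q' 0 1) (q' 1 1), mk_chord ?w (q' 0 (- 1)) (q' 1 (- 1))}"
  have vertex: "\<tau>^2 - 1 = 1 - \<tau>^2 \<longleftrightarrow> \<tau> = 1 \<or> \<tau> = -1" for \<tau> :: real
    using power2_eq_1_iff[of \<tau>] by auto
  have two: "{mk_chord (h j < h i) (r i \<tau>) (r j \<tau>) | i j \<tau>. i < j \<and> j < length Q \<and> \<tau> \<in> {-2..2} \<and>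
      snd ((Q ! i) \<tau>) = snd ((Q ! j) \<tau>)} = {mk_chord ?w (r 0 a) (r 1 a), mk_chord ?w (r 0 b) (r 1 b)}"
    if "length Q = 2"
      "\<And>\<tau>. \<tau> \<in> {-2..2} \<and> snd ((Q ! 0) \<tau>) = snd ((Q ! 1) \<tau>) \<longleftrightarrow> \<tau> = a \<or> \<tau> = b"
    for r :: "nat \<Rightarrow> real \<Rightarrow> real" and Q :: "(real \<Rightarrow> real \<times> real) list" and a b
    unfolding that(1) index_pairs_two that(2) by auto
  have "local_chords ?P' q' (over K') = ?M"
    by (subst B.local_chords_graph, (auto simp: less_Suc_eq)[1], rule two) (use vertex in auto)
  then have G': "gauss_diagram K' = C \<union> ?M" using B.chords by simp
  have param: "q' i \<tau> \<in> {s i..t i}" if "i < 2" "\<tau> \<in> {-2..2}" for i \<tau>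
    by (rule B.param) (use that in simp_all)
  have "gauss_phi C = gauss_phi (C \<union> ?M)"
  proof (rule gauss_phi_R2)
    show "gauss_like C" using A.gauss_like unfolding G .
    show "gauss_like (C \<union> ?M)" using B.gauss_like unfolding G' .
    show "{s 0..t 0} \<inter> {s 1..t 1} = {}" by (rule B.disjoint) simp_all
    show "endpoints C \<inter> ({s 0..t 0} \<union> {s 1..t 1}) = {}"
      using B.outside by (simp add: lessThan_Suc Un_commute)
    show "q' 0 1 \<noteq> q' 0 (- 1)" "q' 1 1 \<noteq> q' 1 (- 1)"
      using B.param_inj[of 0 1 "-1"] B.param_inj[of 1 1 "-1"] by auto
  qed (rule zero_neq_one param; simp)+
  then show ?thesis by (simp add: phi2_def G G')
qed

lemma phi2_R3:
  assumes K: "long_knot_diagram pt K" and K': "long_knot_diagram pt K'" and "R3 K K'"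
  shows "phi2 K = phi2 K'"
proof -
  let ?P = "[\<lambda>\<tau>. (\<tau>, \<tau>), \<lambda>\<tau>. (\<tau>, -\<tau>), \<lambda>\<tau>. (\<tau>, (4 - \<tau>^2) / 3)] :: (real \<Rightarrow> real \<times> real) list"
  let ?P' = "[\<lambda>\<tau>. (\<tau>, \<tau>), \<lambda>\<tau>. (\<tau>, -\<tau>), \<lambda>\<tau>. (\<tau>, -((4 - \<tau>^2) / 3))] :: (real \<Rightarrow> real \<times> real) list"
  have move: "local_move ?P ?P' K K'" using assms(3) by (simp add: R3_def)
  have "(\<tau>, \<tau>) \<in> std_disc" "(\<tau>, -\<tau>) \<in> std_disc"
    "(\<tau>, (4 - \<tau>^2) / 3) \<in> std_disc" "(\<tau>, -((4 - \<tau>^2) / 3)) \<in> std_disc"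
    if "\<tau> \<in> {-2..2}" for \<tau> :: real
  proof -
    define y where "y = \<tau>^2"
    have "0 \<le> y" "y \<le> 4" unfolding y_def by (rule square_bounds[OF that])+
    then show "(\<tau>, \<tau>) \<in> std_disc" "(\<tau>, -\<tau>) \<in> std_disc"
      "(\<tau>, (4 - \<tau>^2) / 3) \<in> std_disc" "(\<tau>, -((4 - \<tau>^2) / 3)) \<in> std_disc"
      using that by (simp_all add: mem_std_disc field_simps flip: y_def)
  qed
  then obtain C s t q q' h where A: "local_picture ?P K C s t q h"
    and B: "local_picture ?P' K' C s t q' h"
    and dir: "\<And>i \<sigma> \<tau> \<sigma>' \<tau>'. \<lbrakk>i < length ?P; \<sigma> \<in> {-2..2}; \<tau> \<in> {-2..2}; \<sigma>' \<in> {-2..2}; \<tau>' \<in> {-2..2}; \<sigma> < \<tau>; \<sigma>' < \<tau>'\<rbrakk>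
      \<Longrightarrow> q i \<sigma> < q i \<tau> \<longleftrightarrow> q' i \<sigma>' < q' i \<tau>'"
    by - (rule local_moveE[OF move K K'], auto simp: less_Suc_eq simp del: atLeastAtMost_iff)
  interpret A: local_picture ?P K C s t q h by (rule A)
  interpret B: local_picture ?P' K' C s t q' h by (rule B)
  let ?w0 = "h 1 < h 0" and ?w1 = "h 2 < h 0" and ?w2 = "h 2 < h 1"
  \<comment> \<open>The arcs 0 and 1 meet at parameter 0. The arc 2 meets them at 1 and -1 before
    the move and at -1 and 1 after it, which reverses the order of the two crossings on every
    arc.\<close>
  let ?M = "{mk_chord ?w0 (q 0 0) (q 1 0), mk_chord ?w1 (q 0 1) (q 2 1),
    mk_chord ?w2 (q 1 (- 1)) (q 2 (- 1))}"
  let ?M' = "{mk_chord ?w0 (q' 0 0) (q' 1 0), mk_chord ?w1 (q' 0 (- 1)) (q' 2 (- 1)),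
    mk_chord ?w2 (q' 1 1) (q' 2 1)}"
  have vertex: "\<tau> = (4 - \<tau>^2) / 3 \<longleftrightarrow> \<tau> = 1" "- \<tau> = (4 - \<tau>^2) / 3 \<longleftrightarrow> \<tau> = -1"
    "\<tau> = - ((4 - \<tau>^2) / 3) \<longleftrightarrow> \<tau> = -1" "- \<tau> = - ((4 - \<tau>^2) / 3) \<longleftrightarrow> \<tau> = 1"
    if "\<tau> \<in> {-2..2}" for \<tau> :: real
  proof -
    \<comment> \<open>The other roots, -4 and 4, lie outside the parameter interval.\<close>
    have "(\<tau> - 1) * (\<tau> + 4) = 0 \<longleftrightarrow> \<tau> = 1" "(\<tau> + 1) * (\<tau> - 4) = 0 \<longleftrightarrow> \<tau> = -1"
      using that by auto
    moreover have "(\<tau> - 1) * (\<tau> + 4) = \<tau>^2 + 3 * \<tau> - 4" "(\<tau> + 1) * (\<tau> - 4) = \<tau>^2 - 3 * \<tau> - 4"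
      by (simp_all add: power2_eq_square algebra_simps)
    ultimately have *: "\<tau> = 1 \<longleftrightarrow> \<tau>^2 + 3 * \<tau> - 4 = 0" "\<tau> = -1 \<longleftrightarrow> \<tau>^2 - 3 * \<tau> - 4 = 0"
      by simp_all
    define y where "y = (4 - \<tau>^2) / 3"
    have "3 * y = 4 - \<tau>^2" by (simp add: y_def)
    then show "\<tau> = (4 - \<tau>^2) / 3 \<longleftrightarrow> \<tau> = 1" "- \<tau> = (4 - \<tau>^2) / 3 \<longleftrightarrow> \<tau> = -1"
      "\<tau> = - ((4 - \<tau>^2) / 3) \<longleftrightarrow> \<tau> = -1" "- \<tau> = - ((4 - \<tau>^2) / 3) \<longleftrightarrow> \<tau> = 1"
      unfolding * y_def[symmetric] by - (rule iffI; linarith)+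
  qed
  have three: "{mk_chord (h j < h i) (r i \<tau>) (r j \<tau>) | i j \<tau>. i < j \<and> j < length Q \<and> \<tau> \<in> {-2..2} \<and>
      snd ((Q ! i) \<tau>) = snd ((Q ! j) \<tau>)}
    = {mk_chord ?w0 (r 0 a) (r 1 a), mk_chord ?w1 (r 0 b) (r 2 b), mk_chord ?w2 (r 1 c) (r 2 c)}"
    if "length Q = 3"
      "\<And>\<tau>. \<tau> \<in> {-2..2} \<and> snd ((Q ! 0) \<tau>) = snd ((Q ! 1) \<tau>) \<longleftrightarrow> \<tau> = a"
      "\<And>\<tau>. \<tau> \<in> {-2..2} \<and> snd ((Q ! 0) \<tau>) = snd ((Q ! 2) \<tau>) \<longleftrightarrow> \<tau> = b"
      "\<And>\<tau>. \<tau> \<in> {-2..2} \<and> snd ((Q ! 1) \<tau>) = snd ((Q ! 2) \<tau>) \<longleftrightarrow> \<tau> = c"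
    for r :: "nat \<Rightarrow> real \<Rightarrow> real" and Q :: "(real \<Rightarrow> real \<times> real) list" and a b c
    unfolding that(1) index_pairs_three that(2-4) by auto
  have "local_chords ?P q (over K) = ?M"
    by (subst A.local_chords_graph, (auto simp: less_Suc_eq)[1], rule three) (use vertex in auto)
  then have G: "gauss_diagram K = C \<union> ?M" using A.chords by simp
  have "local_chords ?P' q' (over K') = ?M'"
    by (subst B.local_chords_graph, (auto simp: less_Suc_eq)[1], rule three) (use vertex in auto)
  then have G': "gauss_diagram K' = C \<union> ?M'" using B.chords by simp
  have param: "q i \<tau> \<in> {s i..t i}" "q' i \<tau> \<in> {s i..t i}" if "i < 3" "\<tau> \<in> {-2..2}" for i \<tau>
    using A.param[of i \<tau>] B.param[of i \<tau>] that by simp_all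
  have inj: "q i \<sigma> \<noteq> q i \<tau>" "q' i \<sigma> \<noteq> q' i \<tau>"
    if "i < 3" "\<sigma> \<in> {-2..2}" "\<tau> \<in> {-2..2}" "\<sigma> \<noteq> \<tau>" for i \<sigma> \<tau>
    using A.param_inj[of i \<sigma> \<tau>] B.param_inj[of i \<sigma> \<tau>] that by auto
  have less: "q i \<sigma> < q i \<tau> \<longleftrightarrow> q' i \<sigma>' < q' i \<tau>'"
    if "i < 3" "\<sigma> \<in> {-2..2}" "\<tau> \<in> {-2..2}" "\<sigma>' \<in> {-2..2}" "\<tau>' \<in> {-2..2}" "\<sigma> < \<tau>" "\<sigma>' < \<tau>'" for i \<sigma> \<tau> \<sigma>' \<tau>'
    by (rule dir) (use that in simp_all)
  \<comment> \<open>On the arcs 1 and 2 the crossing listed first in \<open>?M\<close> has the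
    larger parameter, so the comparison is also needed in this direction.\<close>
  have greater: "q i \<tau> < q i \<sigma> \<longleftrightarrow> q' i \<tau>' < q' i \<sigma>'"
    if "i < 3" "\<sigma> \<in> {-2..2}" "\<tau> \<in> {-2..2}" "\<sigma>' \<in> {-2..2}" "\<tau>' \<in> {-2..2}" "\<sigma> < \<tau>" "\<sigma>' < \<tau>'" for i \<sigma> \<tau> \<sigma>' \<tau>'
    using less[OF that] inj(1)[of i \<sigma> \<tau>] inj(2)[of i \<sigma>' \<tau>'] that by auto
  have "gauss_phi (C \<union> ?M) = gauss_phi (C \<union> ?M')"
  proof (rule gauss_phi_R3)
    show "gauss_like (C \<union> ?M)" using A.gauss_like unfolding G .
    show "gauss_like (C \<union> ?M')" using B.gauss_like unfolding G' .
    show "distinct [0, 1, 2 :: nat]" by simp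
    show "{s 0..t 0} \<inter> {s 1..t 1} = {}" "{s 0..t 0} \<inter> {s 2..t 2} = {}" "{s 1..t 1} \<inter> {s 2..t 2} = {}"
      by (rule A.disjoint; simp)+
    have "{..<length ?P} = {0, 1, 2}" by auto
    then show "endpoints C \<inter> ({s 0..t 0} \<union> {s 1..t 1} \<union> {s 2..t 2}) = {}"
      using A.outside by (simp only: UN_insert UN_empty Un_empty_right Un_assoc)
  qed (rule param inj less greater; simp)+
  then show ?thesis by (simp add: phi2_def G G')
qed

theorem theorem3p3:
  fixes pt :: complex and K K' :: diagram
  assumes "pt \<in> sphere 0 1"
    and "long_knot_diagram pt K" and "long_knot_diagram pt K'"
    and "equivalent_diagrams pt K K'"
  shows "phi2 K = phi2 K'"
proof -
  have step: "phi2 L = phi2 L'" if "diagram_step pt L L'" for L L'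
    using that phi2_planar_isotopic phi2_R1 phi2_R2 phi2_R3 unfolding diagram_step_def by blast
  have "equivclp (diagram_step pt) K K'" using assms(4) by (simp add: equivalent_diagrams_def)
  \<comment> \<open>Equality is symmetric, so \<open>step\<close> serves for both directions of a
    move.\<close>
  then show ?thesis
    by (induction rule: equivclp_induct) (use step in \<open>auto 0 0\<close>)
qed

end
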